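(* Let $F\in C^2(\mathbb{R};\mathbb{R}^N)$, $f=(f_1,\ldots,f_N)=F'$, let $u_0^\pm\in C^1(\mathbb{R}^N)$ have compact support, $g_0\in C^1_b(\mathbb{R}^{N-1})$, let $T>0$ be small enough, and let $u^\pm\in C^1(\mathbb{R}^N\times[0,T])$ be the classical solutions of $$\partial_t u^\pm+f(u^\pm)\cdot\nabla u^\pm=0\ \text{ in }\mathbb{R}^N\times(0,T),\qquad u^\pm(\cdot,0)=u_0^\pm .$$ Let $\mathbf{u}^\pm$ be network minimizers of $\boldsymbol{\mathcal{L}}^\pm$ in $\mathbf{N}_A$, and set $$\boldsymbol{\varepsilon}_i^\pm=\partial_t\mathbf{u}^\pm+f(\mathbf{u}^\pm)\cdot\nabla\mathbf{u}^\pm,\qquad \boldsymbol{\varepsilon}_b^\pm=\mathbf{u}^\pm(\cdot,0)-u_0^\pm,$$ with $(\boldsymbol{\varepsilon}^\pm_i,\boldsymbol{\varepsilon}^\pm_b)\in C^\infty(\mathbb{R}^N\times\mathbb{R})\times C^\infty(\mathbb{R}^N)$. Let $g$ be the unique $C^1$ solution of $$\partial_t g+a(g,x',t)\cdot\nabla_{x'}g-b(g,x',t)=0\ \text{ in }\mathbb{R}^{N-1}\times(0,T),\qquad g(\cdot,0)=g_0 .$$ Let $\mathbf{g}\in\mathbf{N}_{A'}$ be a network minimizer of $\boldsymbol{\mathcal{K}}$, i.e. $\mathbf{g}=\operatorname{argmin}\{\boldsymbol{\mathcal{K}}[\mathbf{h}]:\ \mathbf{h}\in\mathbf{N}_{A'}\}$,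 and let $(\boldsymbol{\sigma}_i,\boldsymbol{\sigma}_b)\in C^\infty(\mathbb{R}^{N-1}\times[0,T])\times C^\infty(\mathbb{R}^{N-1})$ be defined by $$\boldsymbol{\sigma}_i=\partial_t\mathbf{g}+\mathbf{a}(\mathbf{g},x',t)\cdot\nabla_{x'}\mathbf{g}-\mathbf{b}(\mathbf{g},x',t),\qquad \boldsymbol{\sigma}_b=\mathbf{g}(\cdot,0)-g_0 .$$ Then $$\|\mathbf{g}-g\|_{L^\infty(\mathbb{R}^{N-1}\times[0,T])}\le\Big(\|\boldsymbol{\sigma}_b\|_{L^\infty(\mathbb{R}^{N-1})}+\|\boldsymbol{\sigma}_i\|_{L^\infty(\mathbb{R}^{N-1}\times[0,T])}+\sum_{*=\pm}C_0^*\,T\big(\|\boldsymbol{\varepsilon}_b^*\|_{L^\infty(\mathbb{R}^N)}+T\|\boldsymbol{\varepsilon}_i^*\|_{L^\infty(\mathbb{R}^N\times[0,T])}\big)\Big)e^{C_1T},$$ where, writing $R:=\rho_0^++\rho_0^-+\boldsymbol{\rho}_0^++\boldsymbol{\rho}_0^-$ and $G:=\|\nabla_{x'}g\|_{L^\infty(\mathbb{R}^{N-1}\times[0,T])}$, $$C_0^\pm=(1+G)\,\|f'\|_{L^\infty(B(0,R))}\exp\Big(T\rho_1^\pm\|f'\|_{L^\infty(B(0,\rho_0^\pm+\boldsymbol{\rho}_0^\pm))}\Big),$$ $$C_1=(1+G)(\rho_1^++\rho_1^-)\|f'\|_{L^\infty(B(0,R))},$$ $$\rho_0^\pm=\|u_0^\pm\|_{L^\infty(\mathbb{R}^N)},\qquad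 \boldsymbol{\rho}_0^\pm=\|u_0^\pm\|_{L^\infty(\mathbb{R}^N)}+\|\boldsymbol{\varepsilon}_b^\pm\|_{L^\infty(\mathbb{R}^N)}+T\|\boldsymbol{\varepsilon}_i^\pm\|_{L^\infty(\mathbb{R}^N\times[0,T])},$$ $$\rho_1^\pm=\|\nabla u_0^\pm\|_{L^\infty(\mathbb{R}^N)}+C^\pm\|f'\|_{L^\infty(B(0,\rho_0^\pm))},$$ and $C^\pm$ is a constant for which the a priori gradient bound $\|\nabla u^\pm\|_{L^\infty(\mathbb{R}^N\times[0,T])}\le\rho_1^\pm$ holds.
   Context: Notation: $x=(x',x_N)\in\mathbb{R}^N$, $x'=(x_1,\ldots,x_{N-1})$; $\nabla$ is the gradient in $x$ and $\nabla_{x'}$ the gradient in $x'$; $B(0,\rho)$ is the ball of $\mathbb{R}$ of radius $\rho$ centered at $0$; $|\cdot|$ is the Euclidean norm for vectors; $C^1_b$ denotes bounded $C^1$ functions with bounded first derivatives. "$T>0$ small enough" means that the statement holds for all sufficiently small $T>0$, in particular small enough that the classical $C^1$ solutions $u^\pm$ and $g$ exist on $[0,T]$. Coefficients: $a=(a_1,\ldots,a_{N-1})$ and, for $i=1,\ldots,N-1$, $$a_i(g,x',t)=\int_0^1 f_i\big(u^-(x',g,t)+s(u^+(x',g,t)-u^-(x',g,t))\big)ds,$$ $$b(g,x',t)=\int_0^1 f_N\big(u^-(x',g,t)+s(u^+(x',g,t)-u^-(x',g,t))\big)ds .$$ $\mathbf{a}=(\mathbf{a}_1,\ldots,\mathbf{a}_{N-1})$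 and $\mathbf{b}$ are defined by the same formulas with $u^\pm$ replaced by $\mathbf{u}^\pm$. Neural networks. An architecture $[n_0,n_1,\ldots,n_l]$ with $n_l=1$ has parameters $\theta=(\theta^1,\ldots,\theta^l)$, $\theta^i=(w^i,b^i)$, $w^i\in\mathbb{R}^{n_i\times n_{i-1}}$, $b^i\in\mathbb{R}^{n_i}$, and network functions $$y\in\mathbb{R}^{n_0}\mapsto w^l\cdot\sigma\big(w^{l-1}\cdot(\cdots\sigma(w^2\cdot\sigma(w^1\cdot y+b^1)+b^2)\cdots)+b^{l-1}\big)+b^l,$$ with a smooth nonlinear activation function $\sigma:\mathbb{R}\to\mathbb{R}$ applied componentwise. $\mathbf{N}_A$ is the set of all network functions for an architecture $A$ with input $y=(x,t)$ ($n_0=N+1$), and $\mathbf{N}_{A'}$ the set for an architecture $A'$ with input $y=(x',t)$ ($n_0=N$). Losses. For fixed $k,m,p,q\in\mathbb{N}_0$: with $L_i^\pm[\mathbf{u}]=\partial_t\mathbf{u}+f(\mathbf{u})\cdot\nabla\mathbf{u}$ and $L_b^\pm[\mathbf{u}]=\mathbf{u}(\cdot,0)-u_0^\pm$, for $\mathbf{u}\in\mathbf{N}_A$, $$\boldsymbol{\mathcal{L}}^\pm[\mathbf{u}]=\sum_{|\alpha|+\beta\le k}\int_0^T\!\!\int_{\mathbb{R}^N}|D_x^\alpha D_t^\beta L_i^\pm[\mathbf{u}]|^2dx\,dt+\sum_{|\alpha|\le m}\int_{\mathbb{R}^N}|D_x^\alpha L_b^\pm[\mathbf{u}]|^2dx\qquad(\alpha\in\mathbb{N}_0^N,\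 \beta\in\mathbb{N}_0);$$ with $\mathbf{K}_i[\mathbf{h}]=\partial_t\mathbf{h}+\mathbf{a}(\mathbf{h},x',t)\cdot\nabla_{x'}\mathbf{h}-\mathbf{b}(\mathbf{h},x',t)$ and $\mathbf{K}_b[\mathbf{h}]=\mathbf{h}(\cdot,0)-g_0$, for $\mathbf{h}\in\mathbf{N}_{A'}$, $$\boldsymbol{\mathcal{K}}[\mathbf{h}]=\sum_{|\alpha|+\beta\le p}\int_0^T\!\!\int_{\mathbb{R}^{N-1}}|D_{x'}^\alpha D_t^\beta\mathbf{K}_i[\mathbf{h}]|^2dx'\,dt+\sum_{|\alpha|\le q}\int_{\mathbb{R}^{N-1}}|D_{x'}^\alpha\mathbf{K}_b[\mathbf{h}]|^2dx'\qquad(\alpha\in\mathbb{N}_0^{N-1},\ \beta\in\mathbb{N}_0).$$ Minimizations are over the network parameters. *)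

theory Defs
  imports
    "HOL-Probability.Essential_Supremum"
    "Jordan_Normal_Form.Matrix"
begin

text \<open>
  The space of points \<open>x = (x', x\<^sub>N)\<close> is \<^typ>\<open>(real^'n) \<times> real\<close> with \<open>CARD('n) = N - 1\<close>, so \<open>N \<ge> 2\<close>;
  its product norm is the Euclidean norm. Space-time points are pairs \<open>(x, t)\<close> or \<open>(x', t)\<close>.
  The infix dot for \<^const>\<open>inner\<close> and the indexing symbol are overloaded with those of the
  matrix library, so prefix forms are used.
\<close>

datatype pm = Plus | Minus

text \<open>
  Derivatives are taken within the set \<open>S\<close>. On a slab \<open>UNIV \<times> {0..T}\<close> with \<open>T > 0\<close> they are
  unique, and the time derivative is one-sided at \<open>t = 0\<close> and \<open>t = T\<close>. Thus
  \<open>Ck_on k (UNIV \<times> {0..T})\<close> is the class of functions that are \<open>C\<^sup>k\<close> up to the boundary.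
\<close>

definition partial ::
    "'a::euclidean_space set \<Rightarrow> 'a \<Rightarrow> ('a \<Rightarrow> 'b::real_normed_vector) \<Rightarrow> 'a \<Rightarrow> 'b" where
  "partial S b f x = frechet_derivative f (at x within S) b"

fun Ck_on ::
    "nat \<Rightarrow> 'a::euclidean_space set \<Rightarrow> ('a \<Rightarrow> 'b::real_normed_vector) \<Rightarrow> bool" where
  "Ck_on 0 S f \<longleftrightarrow> continuous_on S f"
| "Ck_on (Suc k) S f \<longleftrightarrow> f differentiable_on S \<and> (\<forall>b\<in>Basis. Ck_on k S (partial S b f))"

definition smooth_on :: "'a::euclidean_space set \<Rightarrow> ('a \<Rightarrow> 'b::real_normed_vector) \<Rightarrow> bool" where
  "smooth_on S f \<longleftrightarrow> (\<forall>k. Ck_on k S f)"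

definition grad :: "('a::euclidean_space \<Rightarrow> real) \<Rightarrow> 'a \<Rightarrow> 'a" where
  "grad f x = (THE D. GDERIV f x :> D)"

definition space_grad :: "('a::euclidean_space \<times> real \<Rightarrow> real) \<Rightarrow> 'a \<times> real \<Rightarrow> 'a" where
  "space_grad u = (\<lambda>(x, t). grad (\<lambda>\<xi>. u (\<xi>, t)) x)"

text \<open>
  Network functions need not be bounded on the whole space, so \<open>L\<^sup>\<infinity>\<close> norms take values in
  \<^typ>\<open>ennreal\<close>, with \<open>0 * \<infinity> = 0\<close>. The norm over an empty set (such as \<open>ball0 0\<close>) is \<open>0\<close>.
\<close>

definition Linf_norm :: "'a::euclidean_space set \<Rightarrow> ('a \<Rightarrow> 'b::real_normed_vector) \<Rightarrow> ennreal" where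
  "Linf_norm S f = esssup (lebesgue_on S) (\<lambda>x. ennreal (norm (f x)))"

definition ball0 :: "ennreal \<Rightarrow> real set" where
  "ball0 \<rho> = {v. ennreal \<bar>v\<bar> < \<rho>}"

definition ennexp :: "ennreal \<Rightarrow> ennreal" where
  "ennexp x = (if x = \<infinity> then \<infinity> else ennreal (exp (enn2real x)))"

definition multi_indices :: "nat \<Rightarrow> ('a::euclidean_space \<Rightarrow> nat) set" where
  "multi_indices k = {\<alpha>. (\<forall>b. b \<notin> Basis \<longrightarrow> \<alpha> b = 0) \<and> (\<Sum>b\<in>Basis. \<alpha> b) \<le> k}"

text \<open>
  \<open>from_nat_into Basis\<close> enumerates the basis; for \<open>C\<^sup>k\<close> functions and \<open>|\<alpha>| \<le> k\<close> the order in which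
  the partial derivatives are applied is immaterial.
\<close>

definition multi_deriv ::
    "'a::euclidean_space set \<Rightarrow> ('a \<Rightarrow> nat) \<Rightarrow> ('a \<Rightarrow> real) \<Rightarrow> 'a \<Rightarrow> real" where
  "multi_deriv S \<alpha> w =
     foldr (\<lambda>b v. (partial S b ^^ \<alpha> b) v) (map (from_nat_into Basis) [0..<DIM('a)]) w"

text \<open>
  The sum over \<open>|\<alpha>| \<le> k\<close> of the integrals over \<open>S\<close> of \<open>|D\<^sup>\<alpha> w|\<^sup>2\<close>. If the ambient space is a product
  of space and time, a multi-index over its basis is a pair \<open>(\<alpha>, \<beta>)\<close> of a spatial multi-index and
  a time order, and the condition on the order reads \<open>|\<alpha>| + \<beta> \<le> k\<close>. The value is infinite if an
  integral diverges, and by convention also if \<open>w\<close> is not of class \<open>C\<^sup>k\<close>, that is, if the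
  derivatives in question are not available.
\<close>

definition deriv_energy :: "nat \<Rightarrow> 'a::euclidean_space set \<Rightarrow> ('a \<Rightarrow> real) \<Rightarrow> ennreal" where
  "deriv_energy k S w =
     (if Ck_on k S w
      then \<Sum>\<alpha>\<in>multi_indices k. \<integral>\<^sup>+y\<in>S. ennreal ((multi_deriv S \<alpha> w y)\<^sup>2) \<partial>lborel
      else \<infinity>)"

definition architecture :: "nat \<Rightarrow> nat list \<Rightarrow> bool" where
  "architecture n\<^sub>0 A \<longleftrightarrow> 2 \<le> length A \<and> hd A = n\<^sub>0 \<and> last A = 1 \<and> (\<forall>n\<in>set A. 0 < n)"

definition parameters :: "nat list \<Rightarrow> (real mat \<times> real Matrix.vec) list set" where
  "parameters A = {\<theta>. Suc (length \<theta>) = length A \<and>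
     (\<forall>i<length \<theta>. fst (\<theta> ! i) \<in> carrier_mat (A ! Suc i) (A ! i) \<and>
                    snd (\<theta> ! i) \<in> carrier_vec (A ! Suc i))}"

fun net_eval ::
    "(real \<Rightarrow> real) \<Rightarrow> (real mat \<times> real Matrix.vec) list \<Rightarrow> real Matrix.vec \<Rightarrow> real Matrix.vec" where
  "net_eval \<sigma> [] y = y"
| "net_eval \<sigma> [(w, b)] y = w *\<^sub>v y + b"
| "net_eval \<sigma> ((w, b) # \<theta>) y = net_eval \<sigma> \<theta> (map_vec \<sigma> (w *\<^sub>v y + b))"

text \<open>
  The coordinates are listed in some fixed order. The order does not affect the set of network
  functions, since the columns of the first weight matrix can be permuted.
\<close>

definition coords :: "'a::euclidean_space \<Rightarrow> real Matrix.vec" where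
  "coords y = Matrix.vec DIM('a) (\<lambda>i. inner y (from_nat_into Basis i))"

definition networks :: "(real \<Rightarrow> real) \<Rightarrow> nat list \<Rightarrow> ('a::euclidean_space \<Rightarrow> real) set" where
  "networks \<sigma> A = {\<lambda>y. vec_index (net_eval \<sigma> \<theta> (coords y)) 0 | \<theta>. \<theta> \<in> parameters A}"

definition L_i ::
    "(real \<Rightarrow> 'a) \<Rightarrow> ('a::euclidean_space \<times> real \<Rightarrow> real) \<Rightarrow> 'a \<times> real \<Rightarrow> real" where
  "L_i f u = (\<lambda>(x, t). deriv (\<lambda>s. u (x, s)) t + inner (f (u (x, t))) (space_grad u (x, t)))"

definition L_b :: "('a \<Rightarrow> real) \<Rightarrow> ('a::euclidean_space \<times> real \<Rightarrow> real) \<Rightarrow> 'a \<Rightarrow> real" where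
  "L_b u0 u = (\<lambda>x. u (x, 0) - u0 x)"

definition L_loss ::
    "nat \<Rightarrow> nat \<Rightarrow> real \<Rightarrow> (real \<Rightarrow> 'a) \<Rightarrow> ('a \<Rightarrow> real) \<Rightarrow> ('a::euclidean_space \<times> real \<Rightarrow> real) \<Rightarrow> ennreal"
  where
  "L_loss k m T f u0 u =
     deriv_energy k (UNIV \<times> {0..T}) (L_i f u) + deriv_energy m UNIV (L_b u0 u)"

definition classical_solution ::
    "real \<Rightarrow> (real \<Rightarrow> 'a) \<Rightarrow> ('a \<Rightarrow> real) \<Rightarrow> ('a::euclidean_space \<times> real \<Rightarrow> real) \<Rightarrow> bool" where
  "classical_solution T f u0 u \<longleftrightarrow>
     Ck_on 1 (UNIV \<times> {0..T}) u \<and>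
     (\<forall>x. \<forall>t\<in>{0<..<T}. L_i f u (x, t) = 0) \<and>
     (\<forall>x. u (x, 0) = u0 x)"

text \<open>
  The coefficients are evaluated at the height \<open>z\<close> of the interface. Here \<open>u Plus\<close> and \<open>u Minus\<close>
  are the states on the two sides: either the classical solutions or their network approximations.
\<close>

definition segment_mean ::
    "(real \<Rightarrow> (real^'n) \<times> real) \<Rightarrow> (pm \<Rightarrow> ((real^'n) \<times> real) \<times> real \<Rightarrow> real) \<Rightarrow>
     real \<Rightarrow> real^'n \<Rightarrow> real \<Rightarrow> ((real^'n) \<times> real \<Rightarrow> real) \<Rightarrow> real" where
  "segment_mean f u z x' t \<pi> =
     integral {0..1} (\<lambda>s. \<pi> (f (u Minus ((x', z), t)
                              + s * (u Plus ((x', z), t) - u Minus ((x', z), t)))))"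

definition coeff_a ::
    "(real \<Rightarrow> (real^'n) \<times> real) \<Rightarrow> (pm \<Rightarrow> ((real^'n) \<times> real) \<times> real \<Rightarrow> real) \<Rightarrow>
     real \<Rightarrow> real^'n \<Rightarrow> real \<Rightarrow> real^'n" where
  "coeff_a f u z x' t = (\<chi> i. segment_mean f u z x' t (\<lambda>v. vec_nth (fst v) i))"

definition coeff_b ::
    "(real \<Rightarrow> (real^'n) \<times> real) \<Rightarrow> (pm \<Rightarrow> ((real^'n) \<times> real) \<times> real \<Rightarrow> real) \<Rightarrow>
     real \<Rightarrow> real^'n \<Rightarrow> real \<Rightarrow> real" where
  "coeff_b f u z x' t = segment_mean f u z x' t snd"

definition K_i ::
    "(real \<Rightarrow> (real^'n) \<times> real) \<Rightarrow> (pm \<Rightarrow> ((real^'n) \<times> real) \<times> real \<Rightarrow> real) \<Rightarrow>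
     ((real^'n) \<times> real \<Rightarrow> real) \<Rightarrow> (real^'n) \<times> real \<Rightarrow> real" where
  "K_i f u h = (\<lambda>(x', t).
     deriv (\<lambda>s. h (x', s)) t
     + inner (coeff_a f u (h (x', t)) x' t) (space_grad h (x', t))
     - coeff_b f u (h (x', t)) x' t)"

definition K_b :: "(real^'n \<Rightarrow> real) \<Rightarrow> ((real^'n) \<times> real \<Rightarrow> real) \<Rightarrow> real^'n \<Rightarrow> real" where
  "K_b g0 h = (\<lambda>x'. h (x', 0) - g0 x')"

definition K_loss ::
    "nat \<Rightarrow> nat \<Rightarrow> real \<Rightarrow> (real \<Rightarrow> (real^'n) \<times> real) \<Rightarrow>
     (pm \<Rightarrow> ((real^'n) \<times> real) \<times> real \<Rightarrow> real) \<Rightarrow> (real^'n \<Rightarrow> real) \<Rightarrow>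
     ((real^'n) \<times> real \<Rightarrow> real) \<Rightarrow> ennreal" where
  "K_loss p q T f u g0 h =
     deriv_energy p (UNIV \<times> {0..T}) (K_i f u h) + deriv_energy q UNIV (K_b g0 h)"

definition interface_solution ::
    "real \<Rightarrow> (real \<Rightarrow> (real^'n) \<times> real) \<Rightarrow> (pm \<Rightarrow> ((real^'n) \<times> real) \<times> real \<Rightarrow> real) \<Rightarrow>
     (real^'n \<Rightarrow> real) \<Rightarrow> ((real^'n) \<times> real \<Rightarrow> real) \<Rightarrow> bool" where
  "interface_solution T f u g0 g \<longleftrightarrow>
     Ck_on 1 (UNIV \<times> {0..T}) g \<and>
     (\<forall>x'. \<forall>t\<in>{0<..<T}. K_i f u g (x', t) = 0) \<and>
     (\<forall>x'. g (x', 0) = g0 x')"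

end

theory Submission
  imports Defs
begin

text \<open>
  The errors \<open>U - u\<close> and \<open>h - g\<close> satisfy linear transport equations with source terms, to which
  Gronwall's inequality along backward characteristics applies. A maximum principle in backward
  cones replaces the characteristics. The difference of the coefficients is the difference of the
  averages of \<open>f\<close> over two segments of states, bounded by \<open>|f'|\<close> times \<open>|U - u| + |\<nabla>u| |h - g|\<close>; the
  factor \<open>1 + |\<nabla>g|\<close> comes from the equation for \<open>g\<close>. Smallness of \<open>T\<close> enters only as \<open>T \<le> 1\<close>, which
  absorbs the factor \<open>T\<close> in front of the interior residual of \<open>h\<close>.
\<close>

section \<open>A maximum principle for transport equations\<close>

text \<open>Each error equation is written along the speed of the approximation:
  \<open>f (U (y, s))\<close> for the states, \<open>coeff_a\<close> of \<open>U\<close> at the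
  height \<open>h\<close> for the interface. The remainder then multiplies the gradient of the exact
  solution. This is why the constants contain \<rho>_1 and \<open>G\<close> but no derivative of a
  network. The obstacle is that nothing is bounded in advance. Networks may be unbounded, so
  residual norms, the radius \<open>R\<close> and \<open>G\<close> can be \<infinity>, and the
  speeds have no global bound. State bounds therefore come before any comparison: they confine exact
  and approximate states to one ball, on which \<open>f\<close> is bounded and Lipschitz. The bound
  on \<open>f\<close> only fixes the aperture \<open>B\<close> of the cone and disappears from the
  estimate. All analysis is done with real constants, and norms in \<open>ennreal\<close> enter at
  the end. Because 0 * \<infinity> = 0, a finite right-hand side does not force finite residuals,
  which creates one degenerate case beside the main one.\<close>

text \<open>
  At an interior maximum over the backward cone, the segment in direction \<open>(-V, -1)\<close> stays in the
  cone because \<open>|V| \<le> B\<close>, so no boundary terms arise. The hypothesis is needed only where \<open>w \<ge> 0\<close>,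
  which allows \<open>V\<close> to be unbounded elsewhere.
\<close>

lemma transport_max_principle:
  fixes w :: "'a::euclidean_space \<times> real \<Rightarrow> real"
  assumes cont: "continuous_on (UNIV \<times> {0..t0}) w"
    and nonneg: "0 \<le> t0" "0 \<le> B" "0 \<le> d" "0 \<le> m"
    and init: "\<And>y. w (y, 0) \<le> m"
    and step: "\<And>y s. 0 < s \<Longrightarrow> s \<le> t0 \<Longrightarrow> norm (y - x0) \<le> B * (t0 - s) \<Longrightarrow> 0 \<le> w (y, s) \<Longrightarrow>
      \<exists>D V. (w has_derivative D) (at (y, s)) \<and> norm V \<le> B \<and> D (V, 1) \<le> c * w (y, s) + d"
    and c: "0 \<le> c"
  shows "w (x0, t0) \<le> (m + t0 * d) * exp (t0 * c)"
proof -
  define K where "K = {p :: 'a \<times> real. 0 \<le> snd p \<and> snd p \<le> t0 \<and> norm (fst p - x0) \<le> B * (t0 - snd p)}"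
  have "closed K"
    unfolding K_def by (intro closed_Collect_conj closed_Collect_le continuous_intros)
  have "K \<subseteq> cball x0 (B * t0) \<times> {0..t0}"
    using nonneg by (auto simp: K_def dist_norm norm_minus_commute algebra_simps)
      (smt (verit) mult_nonneg_nonneg)
  then have "bounded K"
    by (rule bounded_subset[OF bounded_Times[OF bounded_cball bounded_closed_interval]])
  with \<open>closed K\<close> have "compact K"
    by (simp add: compact_eq_bounded_closed)
  have x0K: "(x0, t0) \<in> K" using nonneg by (simp add: K_def)
  have bound: "exp (- (c * t0)) * w (x0, t0) - (d + \<eta>) * t0 \<le> m" if "0 < \<eta>" for \<eta>
  proof -
    \<comment> \<open>The weight compensates the growth rate \<open>c\<close>, the linear term the
      source \<open>d\<close>. The extra \<eta> makes the derivative of \<phi> along (-V, -1)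
      strictly positive, so that a maximum at positive time with \<open>w\<close> nonnegative is
      impossible.\<close>
    define \<phi> where "\<phi> = (\<lambda>p. exp (- (c * snd p)) * w p - (d + \<eta>) * snd p)"
    have "continuous_on K \<phi>"
      unfolding \<phi>_def
      by (intro continuous_intros continuous_on_subset[OF cont]) (auto simp: K_def)
    then obtain y s where ys: "(y, s) \<in> K" and max: "\<And>p. p \<in> K \<Longrightarrow> \<phi> p \<le> \<phi> (y, s)"
      using continuous_attains_sup[OF \<open>compact K\<close>] x0K by (metis empty_iff surj_pair)
    have "\<phi> (y, s) \<le> m"
    proof (cases "s = 0")
      case True
      then show ?thesis using init by (simp add: \<phi>_def)
    next
      case False
      with ys have s: "0 < s" "s \<le> t0" "norm (y - x0) \<le> B * (t0 - s)" by (auto simp: K_def)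
      show ?thesis
      \<comment> \<open>Where \<open>w\<close> is negative the hypothesis \<open>step\<close> gives
        nothing, but there \<phi> \<le> 0 \<le> m holds directly.\<close>
      proof (cases "w (y, s) < 0")
        case True
        then have "exp (- (c * s)) * w (y, s) \<le> 0" "0 \<le> (d + \<eta>) * s"
          using s \<open>0 < \<eta>\<close> nonneg by (auto simp: mult_nonneg_nonpos)
        then show ?thesis using nonneg unfolding \<phi>_def snd_conv by linarith
      next
        case False
        then obtain D V where D: "(w has_derivative D) (at (y, s))" and V: "norm V \<le> B"
          and le: "D (V, 1) \<le> c * w (y, s) + d"
          using step[OF s] by force
        define \<gamma> where "\<gamma> \<tau> = \<phi> (y - \<tau> *\<^sub>R V, s - \<tau>)" for \<tau>
        have "((\<lambda>\<tau>. w (y - \<tau> *\<^sub>R V, s - \<tau>)) has_derivative (\<lambda>\<tau>. D (- \<tau> *\<^sub>R V, - \<tau>))) (at 0)"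
          by (rule has_derivative_compose[where f = "\<lambda>\<tau>. (y - \<tau> *\<^sub>R V, s - \<tau>)" and g = w])
            (auto intro!: derivative_eq_intros D)
        moreover have "(\<lambda>\<tau>. D (- \<tau> *\<^sub>R V, - \<tau>)) = (*) (- D (V, 1))"
          using linear_cmul[OF has_derivative_linear[OF D], of "- _" "(V, 1)"]
          by (auto simp: fun_eq_iff)
        ultimately have "((\<lambda>\<tau>. w (y - \<tau> *\<^sub>R V, s - \<tau>)) has_real_derivative - D (V, 1)) (at 0)"
          unfolding has_field_derivative_def by metis
        then have "(\<gamma> has_real_derivative exp (- (c * s)) * (c * w (y, s) - D (V, 1)) + (d + \<eta>)) (at 0)"
          unfolding \<gamma>_def \<phi>_def
          by (auto intro!: derivative_eq_intros simp: algebra_simps)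
        moreover have "0 < exp (- (c * s)) * (c * w (y, s) - D (V, 1)) + (d + \<eta>)"
        proof -
          have "exp (- (c * s)) * (D (V, 1) - c * w (y, s)) \<le> exp (- (c * s)) * d"
            using le by simp
          also have "\<dots> \<le> 1 * d" using c s nonneg by (intro mult_right_mono) auto
          finally show ?thesis using \<open>0 < \<eta>\<close> by (simp add: algebra_simps)
        qed
        ultimately have "\<exists>\<delta>>0. \<forall>\<tau>>0. \<tau> < \<delta> \<longrightarrow> \<gamma> 0 < \<gamma> (0 + \<tau>)"
          by (rule DERIV_pos_inc_right)
        then obtain \<delta> where \<delta>: "0 < \<delta>" "\<And>\<tau>. 0 < \<tau> \<Longrightarrow> \<tau> < \<delta> \<Longrightarrow> \<gamma> 0 < \<gamma> \<tau>"
          unfolding add_0 by blast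
        \<comment> \<open>Below \<delta> the value of \<phi> has risen above its maximum; below
          \<open>s\<close> the shifted point still has positive time and so can lie in
          \<open>K\<close>.\<close>
        define \<tau> where "\<tau> = min \<delta> s / 2"
        have \<tau>: "0 < \<tau>" "\<tau> < \<delta>" "\<tau> < s" using \<delta> s by (auto simp: \<tau>_def)
        have "norm (y - \<tau> *\<^sub>R V - x0) \<le> norm (y - x0) + \<tau> * norm V"
          using norm_triangle_ineq4[of "y - x0" "\<tau> *\<^sub>R V"] \<tau> by (simp add: algebra_simps)
        also have "\<dots> \<le> B * (t0 - s) + \<tau> * B"
          using V s \<tau> by (intro add_mono mult_left_mono) auto
        finally have "(y - \<tau> *\<^sub>R V, s - \<tau>) \<in> K"
          using \<tau> s by (simp add: K_def algebra_simps)
        from max[OF this] \<delta>(2)[OF \<tau>(1,2)] show ?thesis by (simp add: \<gamma>_def)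
      qed
    qed
    with max[OF x0K] show ?thesis by (simp add: \<phi>_def)
  qed
  have "exp (- (c * t0)) * w (x0, t0) \<le> m + t0 * d"
  proof (rule field_le_epsilon)
    fix e :: real assume "0 < e"
    \<comment> \<open>This is the limit \<eta> -> 0. Dividing by \<open>t0 + 1\<close> rather than
      \<open>t0\<close> also covers \<open>t0 = 0\<close>.\<close>
    with nonneg have pos: "0 < e / (t0 + 1)" by simp
    have "e / (t0 + 1) * t0 \<le> e" using \<open>0 < e\<close> nonneg by (simp add: field_simps)
    with bound[OF pos] show "exp (- (c * t0)) * w (x0, t0) \<le> m + t0 * d + e"
      by (simp add: algebra_simps)
  qed
  then show ?thesis
    by (simp add: exp_minus field_simps)
qed

text \<open>
  The speed \<open>f(w)\<close> is not assumed bounded. The test function \<open>\<delta> - \<surd>((w - v)\<^sup>2 + \<kappa>\<^sup>2)\<close> with \<open>v = w(x, t)\<close>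
  is nonnegative only where \<open>w\<close> is close to \<open>v\<close>, and 1-Lipschitz in \<open>w\<close>.
\<close>

lemma transport_bound:
  fixes w \<epsilon> :: "'a::euclidean_space \<times> real \<Rightarrow> real" and f :: "real \<Rightarrow> 'a"
  assumes cont: "continuous_on (UNIV \<times> {0..T}) w" and f: "continuous_on UNIV f"
    and E: "0 \<le> E" and m: "0 \<le> m" and init: "\<And>y. \<bar>w (y, 0)\<bar> \<le> m"
    and transport: "\<And>y s. 0 < s \<Longrightarrow> s < T \<Longrightarrow>
      \<exists>D. (w has_derivative D) (at (y, s)) \<and> \<bar>D (f (w (y, s)), 1)\<bar> \<le> E"
    and t: "0 \<le> t" "t < T"
  shows "\<bar>w (x, t)\<bar> \<le> m + t * E"
proof (rule field_le_epsilon)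
  fix \<kappa> :: real assume \<kappa>: "0 < \<kappa>"
  define v where "v = w (x, t)"
  \<comment> \<open>With this \<delta>, \<open>z\<close> equals |v| at (x, t), while at time 0 the
    reverse triangle inequality gives z \<le> |w| + \<kappa> \<le> m + \<kappa>. The \<kappa> under
    the root makes the absolute value differentiable.\<close>
  define \<delta> where "\<delta> = \<bar>v\<bar> + \<kappa>"
  define z where "z p = \<delta> - sqrt ((w p - v)\<^sup>2 + \<kappa>\<^sup>2)" for p
  have z_le: "z p \<le> \<delta> - \<bar>w p - v\<bar>" for p
    by (simp add: z_def real_le_rsqrt)
  have pos: "0 < (w p - v)\<^sup>2 + \<kappa>\<^sup>2" for p
    using \<kappa> by (simp add: add_nonneg_pos)
  have "compact (f ` {v - \<delta>..v + \<delta>})"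
    by (intro compact_continuous_image continuous_on_subset[OF f]) auto
  then have "bounded (f ` {v - \<delta>..v + \<delta>})"
    by (rule compact_imp_bounded)
  then obtain B where "\<forall>r\<in>{v - \<delta>..v + \<delta>}. norm (f r) \<le> B"
    by (auto simp only: bounded_iff ball_simps)
  \<comment> \<open>By \<open>z_le\<close>, this range of \<open>r\<close> contains every value of
    \<open>w\<close> at points where \<open>z\<close> is nonnegative, so \<open>B\<close> bounds the
    speed wherever the maximum principle asks for it.\<close>
  then have B: "norm (f r) \<le> B" if "\<bar>r - v\<bar> \<le> \<delta>" for r
    using that by (auto simp: abs_le_iff)
  have B0: "0 \<le> B" using order_trans[OF norm_ge_zero B[of v]] \<kappa> by (simp add: \<delta>_def)
  have "z (x, t) \<le> (m + \<kappa> + t * E) * exp (t * 0)"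
  proof (rule transport_max_principle[where B = B])
    show "continuous_on (UNIV \<times> {0..t}) z"
      unfolding z_def by (intro continuous_intros continuous_on_subset[OF cont]) (use t in auto)
    show "z (y, 0) \<le> m + \<kappa>" for y
      using z_le[of "(y, 0)"] init[of y] by (simp add: \<delta>_def)
    fix y s assume s: "0 < s" "s \<le> t" "0 \<le> z (y, s)"
    obtain D where D: "(w has_derivative D) (at (y, s))" and DE: "\<bar>D (f (w (y, s)), 1)\<bar> \<le> E"
      using transport s t by (metis order.strict_trans1)
    define q where "q = sqrt ((w (y, s) - v)\<^sup>2 + \<kappa>\<^sup>2)"
    have q: "0 < q" "\<bar>w (y, s) - v\<bar> \<le> q"
      using pos by (auto simp: q_def intro: real_le_rsqrt)
    have "((\<lambda>p. (w p - v)\<^sup>2 + \<kappa>\<^sup>2) has_derivative (\<lambda>k. 2 * ((w (y, s) - v) * D k))) (at (y, s))"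
      by (auto intro!: derivative_eq_intros D)
    from has_derivative_diff[OF has_derivative_const has_derivative_real_sqrt[OF pos this], of \<delta>]
    have "(z has_derivative (\<lambda>k. 0 - 2 * ((w (y, s) - v) * D k) * (inverse q / 2))) (at (y, s))"
      unfolding z_def[abs_def] q_def mult.commute[of "inverse _ / 2"] .
    then have "(z has_derivative (\<lambda>k. - ((w (y, s) - v) / q * D k))) (at (y, s))"
      by (rule has_derivative_eq_rhs) (use q in \<open>simp add: fun_eq_iff field_simps\<close>)
    moreover have "norm (f (w (y, s))) \<le> B"
      using z_le[of "(y, s)"] s by (intro B) simp
    moreover have "- ((w (y, s) - v) / q * D (f (w (y, s)), 1)) \<le> 0 * z (y, s) + E"
    proof -
      have "\<bar>(w (y, s) - v) / q * D (f (w (y, s)), 1)\<bar> \<le> 1 * E"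
        unfolding abs_mult using q DE by (intro mult_mono) auto
      then show ?thesis by linarith
    qed
    ultimately show "\<exists>D V. (z has_derivative D) (at (y, s)) \<and> norm V \<le> B \<and> D (V, 1) \<le> 0 * z (y, s) + E"
      by blast
  qed (use m \<kappa> E t B0 in auto)
  then have "\<delta> - \<kappa> \<le> m + \<kappa> + t * E" using \<kappa> by (simp add: z_def v_def)
  then show "\<bar>w (x, t)\<bar> \<le> m + t * E + \<kappa>" by (simp add: \<delta>_def v_def)
qed

section \<open>Essential suprema and gradients on slabs\<close>

text \<open>An essential supremum ignores null sets, but a value above it at a point of continuity
  would persist on a nonempty open set, which is not negligible. The open set \<open>Q\<close> is
  separate from \<open>S\<close> so that the open slab can be used inside the closed one.\<close>

lemma Linf_norm_ge:
  fixes f :: "'a::euclidean_space \<Rightarrow> 'b::real_normed_vector"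
  assumes Q: "open Q" "Q \<subseteq> S" and S: "S \<in> sets lebesgue"
    and cont: "continuous_on Q f" and x: "x \<in> Q"
  shows "ennreal (norm (f x)) \<le> Linf_norm S f"
proof (rule ccontr)
  assume less: "\<not> ennreal (norm (f x)) \<le> Linf_norm S f"
  then obtain l where l: "0 \<le> l" "Linf_norm S f = ennreal l"
    by (cases "Linf_norm S f") auto
  define N where "N = Q \<inter> (\<lambda>y. norm (f y)) -` {l<..}"
  have "open N"
    unfolding N_def using Q cont by (intro continuous_open_preimage continuous_intros) auto
  moreover have "x \<in> N"
    using less l x by (auto simp: N_def not_le ennreal_less_iff)
  moreover have "negligible N"
  proof -
    have "AE y in lebesgue_on S. ennreal (norm (f y)) \<le> ennreal l"
      using esssup_AE l(2) unfolding Linf_norm_def by metis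
    then have "AE y in lebesgue. y \<in> S \<longrightarrow> norm (f y) \<le> l"
      using S l by (subst (asm) AE_restrict_space_iff) auto
    then obtain N' where "N' \<in> null_sets lebesgue" "\<And>y. y \<notin> N' \<Longrightarrow> y \<in> S \<Longrightarrow> norm (f y) \<le> l"
      by (auto simp: eventually_ae_filter)
    moreover from this have "N \<subseteq> N'"
      using Q by (force simp: N_def)
    ultimately show ?thesis
      using negligible_iff_null_sets negligible_subset by blast
  qed
  ultimately show False
    using open_not_negligible by blast
qed

lemma Linf_norm_le:
  fixes f :: "'a::euclidean_space \<Rightarrow> 'b::real_normed_vector"
  assumes "S \<in> sets lebesgue" "continuous_on S f" "\<And>x. x \<in> S \<Longrightarrow> ennreal (norm (f x)) \<le> c"
  shows "Linf_norm S f \<le> c"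
  unfolding Linf_norm_def
proof (rule esssup_I)
  have "f \<in> borel_measurable (lebesgue_on S)"
    using assms by (intro continuous_imp_measurable_on_sets_lebesgue)
  then show "(\<lambda>x. ennreal (norm (f x))) \<in> borel_measurable (lebesgue_on S)"
    by measurable
  show "AE x in lebesgue_on S. ennreal (norm (f x)) \<le> c"
    by (rule AE_I2) (use assms in auto)
qed

lemma slab_in_lebesgue: "(UNIV :: 'a::euclidean_space set) \<times> {0..T::real} \<in> sets lebesgue"
  by (simp add: closed_Times lebesgue_closedin borel_closed sets_completionI_sets)

lemma slab_Linf_norm_ge:
  fixes f :: "'a::euclidean_space \<times> real \<Rightarrow> 'b::real_normed_vector"
  assumes "continuous_on (UNIV \<times> {0<..<T}) f" "0 < t" "t < T"
  shows "ennreal (norm (f (x, t))) \<le> Linf_norm (UNIV \<times> {0..T}) f"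
  by (rule Linf_norm_ge[where Q = "UNIV \<times> {0<..<T}"])
    (use assms slab_in_lebesgue in \<open>auto intro: open_Times\<close>)

text \<open>The equations hold only for 0 < t < T, so pointwise error bounds are available only
  there; continuity carries them to t = 0 and t = T.\<close>

lemma slab_Linf_norm_le:
  fixes f :: "'a::euclidean_space \<times> real \<Rightarrow> real"
  assumes T: "0 < T" and cont: "continuous_on (UNIV \<times> {0..T}) f"
    and le: "\<And>x t. 0 < t \<Longrightarrow> t < T \<Longrightarrow> ennreal \<bar>f (x, t)\<bar> \<le> c"
  shows "Linf_norm (UNIV \<times> {0..T}) f \<le> c"
proof (cases c)
  case (real r)
  have cl: "closure (UNIV \<times> {0<..<T}) = (UNIV :: 'a set) \<times> {0..T}"
    using T by (simp add: closure_Times)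
  have "norm (f p) \<le> r" if "p \<in> UNIV \<times> {0..T}" for p
    by (rule continuous_on_closure_norm_le[where s = "UNIV \<times> {0<..<T}"])
      (use cl cont that le real in auto)
  then show ?thesis
    using cont slab_in_lebesgue real by (intro Linf_norm_le) (auto simp: ennreal_leI)
qed simp

section \<open>Gradients as representatives of derivatives, and their behaviour on slabs\<close>

lemma inner_grad:
  assumes "(f has_derivative D) (at x)"
  shows "inner v (grad f x) = D v"
proof -
  have eq: "D h = inner h (\<Sum>b\<in>Basis. D b *\<^sub>R b)" for h
  proof -
    have "D h = D (\<Sum>b\<in>Basis. inner h b *\<^sub>R b)" by (simp add: euclidean_representation)
    also have "\<dots> = (\<Sum>b\<in>Basis. inner h b * D b)"
      using has_derivative_linear[OF assms] by (simp add: linear_sum linear_cmul o_def)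
    also have "\<dots> = inner h (\<Sum>b\<in>Basis. D b *\<^sub>R b)"
      by (simp add: inner_sum_right mult.commute)
    finally show ?thesis .
  qed
  then have 1: "GDERIV f x :> (\<Sum>b\<in>Basis. D b *\<^sub>R b)"
    using assms by (simp add: gderiv_def flip: eq)
  \<comment> \<open>Uniqueness is required because \<open>grad\<close> is a definite
    description.\<close>
  have 2: "d = (\<Sum>b\<in>Basis. D b *\<^sub>R b)" if "GDERIV f x :> d" for d
  proof (rule vector_eq_ldot[THEN iffD1], rule allI)
    fix h
    have "(\<lambda>h. inner h d) = D"
      using that assms by (auto simp: gderiv_def intro: has_derivative_unique)
    then show "inner h d = inner h (\<Sum>b\<in>Basis. D b *\<^sub>R b)"
      using eq by metis
  qed
  have 3: "grad f x = (\<Sum>b\<in>Basis. D b *\<^sub>R b)"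
    unfolding grad_def using 1 2 by blast
  show ?thesis
    unfolding 3 by (rule eq[symmetric])
qed

lemma grad_eq:
  assumes "(f has_derivative D) (at x)"
  shows "grad f x = (\<Sum>b\<in>Basis. D b *\<^sub>R b)"
  by (rule euclidean_eqI) (simp add: inner_commute[of "grad f x"] inner_grad[OF assms])

text \<open>Splitting (v, 1) = (v, 0) + (0, 1) turns the differential operators \<open>L_i\<close>
  and \<open>K_i\<close> into derivatives of one function in the direction (speed, 1), the form that
  the maximum principle expects.\<close>

lemma has_derivative_space_grad:
  fixes u :: "'a::euclidean_space \<times> real \<Rightarrow> real"
  assumes D: "(u has_derivative D) (at (x, t))"
  shows "((\<lambda>\<xi>. u (\<xi>, t)) has_derivative (\<lambda>v. D (v, 0))) (at x)"
    and "inner v (space_grad u (x, t)) = D (v, 0)"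
    and "D (v, 1) = deriv (\<lambda>s. u (x, s)) t + inner v (space_grad u (x, t))"
proof -
  show 1: "((\<lambda>\<xi>. u (\<xi>, t)) has_derivative (\<lambda>v. D (v, 0))) (at x)"
    by (rule has_derivative_compose[where f = "\<lambda>\<xi>. (\<xi>, t)" and g = u])
      (auto intro!: derivative_eq_intros D)
  show 2: "inner v (space_grad u (x, t)) = D (v, 0)"
    unfolding space_grad_def using inner_grad[OF 1] by simp
  have "((\<lambda>s. u (x, s)) has_derivative (\<lambda>\<tau>. D (0, \<tau>))) (at t)"
    by (rule has_derivative_compose[where f = "\<lambda>s. (x, s)" and g = u])
      (auto intro!: derivative_eq_intros D)
  moreover have "(\<lambda>\<tau>. D (0, \<tau>)) = (*) (D (0, 1))"
  proof
    fix \<tau> show "D (0, \<tau>) = D (0, 1) * \<tau>"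
      using linear_cmul[OF has_derivative_linear[OF D], of \<tau> "(0, 1)"] by simp
  qed
  ultimately have "deriv (\<lambda>s. u (x, s)) t = D (0, 1)"
    by (intro DERIV_imp_deriv) (metis has_field_derivative_def)
  then show "D (v, 1) = deriv (\<lambda>s. u (x, s)) t + inner v (space_grad u (x, t))"
    using linear_add[OF has_derivative_linear[OF D], of "(v, 0)" "(0, 1)"] 2 by simp
qed

lemma Ck_on_1_slab:
  fixes u :: "'a::euclidean_space \<times> real \<Rightarrow> real"
  assumes u: "Ck_on 1 (UNIV \<times> {0..T}) u"
  shows "continuous_on (UNIV \<times> {0..T}) u"
    and "0 < t \<Longrightarrow> t < T \<Longrightarrow> (u has_derivative frechet_derivative u (at (x, t) within UNIV \<times> {0..T})) (at (x, t))"
    and "\<exists>\<gamma>. continuous_on (UNIV \<times> {0..T}) \<gamma> \<and> (\<forall>x t. 0 < t \<longrightarrow> t < T \<longrightarrow> space_grad u (x, t) = \<gamma> (x, t))"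
    and "continuous_on (UNIV \<times> {0<..<T}) (space_grad u)"
proof -
  let ?S = "(UNIV :: 'a set) \<times> {0..T}"
  have diff: "u differentiable_on ?S" and cont: "\<And>b. b \<in> Basis \<Longrightarrow> continuous_on ?S (partial ?S b u)"
    using u by auto
  show "continuous_on ?S u"
    by (rule differentiable_imp_continuous_on[OF diff])
  have der: "(u has_derivative frechet_derivative u (at (x, t) within ?S)) (at (x, t))"
    if "0 < t" "t < T" for x t
  proof -
    have "(x, t) \<in> interior ?S" using that by (simp add: interior_Times)
    then have "at (x, t) within ?S = at (x, t)" by (rule at_within_interior)
    moreover have "(u has_derivative frechet_derivative u (at (x, t) within ?S)) (at (x, t) within ?S)"
      using diff that by (auto simp: differentiable_on_def frechet_derivative_works)
    ultimately show ?thesis by metis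
  qed
  then show "0 < t \<Longrightarrow> t < T \<Longrightarrow> (u has_derivative frechet_derivative u (at (x, t) within ?S)) (at (x, t))" .
  \<comment> \<open>Built from derivatives within the slab, \<gamma> is continuous up to t = 0 and t
    = T. It bounds \<open>space_grad\<close> on compact sets that reach the boundary of the
    slab.\<close>
  define \<gamma> where "\<gamma> p = (\<Sum>b\<in>Basis. partial ?S (b, 0) u p *\<^sub>R b)" for p
  have \<gamma>: "continuous_on ?S \<gamma>"
    unfolding \<gamma>_def by (intro continuous_intros cont) (simp add: Basis_prod_def)
  have eq: "space_grad u (x, t) = \<gamma> (x, t)" if "0 < t" "t < T" for x t
    unfolding space_grad_def \<gamma>_def partial_def
    using grad_eq[OF has_derivative_space_grad(1)[OF der[OF that]]] by simp
  show "\<exists>\<gamma>. continuous_on ?S \<gamma> \<and> (\<forall>x t. 0 < t \<longrightarrow> t < T \<longrightarrow> space_grad u (x, t) = \<gamma> (x, t))"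
    using \<gamma> eq by blast
  show "continuous_on (UNIV \<times> {0<..<T}) (space_grad u)"
    using continuous_on_subset[OF \<gamma>, of "UNIV \<times> {0<..<T}"]
    by (rule continuous_on_eq) (auto simp: eq)
qed

lemma Linf_norm_compact_support:
  fixes f :: "'a::euclidean_space \<Rightarrow> 'b::real_normed_vector"
  assumes "continuous_on UNIV f" "compact K" "\<And>x. x \<notin> K \<Longrightarrow> f x = 0"
  shows "Linf_norm UNIV f < \<infinity>"
proof -
  have "compact (f ` K)"
    by (intro compact_continuous_image continuous_on_subset[OF assms(1)] assms) auto
  then obtain B where "0 < B" "\<forall>x\<in>K. norm (f x) \<le> B"
    by (auto dest!: compact_imp_bounded simp: bounded_pos)
  then have "norm (f x) \<le> B" for x
    using assms(3)[of x] by (cases "x \<in> K") auto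
  then have "Linf_norm UNIV f \<le> ennreal B"
    by (intro Linf_norm_le) (use assms in \<open>auto simp: ennreal_leI\<close>)
  then show ?thesis by (simp add: order_le_less_trans)
qed

lemma C1_compact_support_finite:
  fixes f :: "'a::euclidean_space \<Rightarrow> real"
  assumes C1: "Ck_on 1 UNIV f" and K: "compact (closure {x. f x \<noteq> 0})"
  shows "Linf_norm UNIV f < \<infinity>" "Linf_norm UNIV (grad f) < \<infinity>" "continuous_on UNIV f"
proof -
  let ?K = "closure {x. f x \<noteq> 0}"
  have diff: "f differentiable (at x)" for x
    using C1 by (auto simp: differentiable_on_def)
  then have der: "(f has_derivative frechet_derivative f (at x)) (at x)" for x
    by (simp add: frechet_derivative_works)
  have cont: "continuous_on UNIV (partial UNIV b f)" if "b \<in> Basis" for b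
    using C1 that by auto
  show f: "continuous_on UNIV f"
    using C1 by (simp add: differentiable_imp_continuous_on)
  have zero: "f x = 0" if "x \<notin> ?K" for x
    using that subsetD[OF closure_subset, of x "{x. f x \<noteq> 0}"] by auto
  with f K show "Linf_norm UNIV f < \<infinity>"
    by (rule Linf_norm_compact_support)
  have "grad f = (\<lambda>x. \<Sum>b\<in>Basis. partial UNIV b f x *\<^sub>R b)"
    using grad_eq[OF der] by (auto simp: partial_def)
  then have "continuous_on UNIV (grad f)"
    by (auto intro!: continuous_intros cont)
  then show "Linf_norm UNIV (grad f) < \<infinity>"
    using K
  proof (rule Linf_norm_compact_support)
    fix x assume x: "x \<notin> ?K"
    have "(f has_derivative (\<lambda>_. 0)) (at x)"
    proof (rule has_derivative_transform_within_open[OF has_derivative_const[of 0]])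
      show "open (- ?K)" by (rule open_Compl[OF closed_closure])
      show "x \<in> - ?K" unfolding Compl_iff by (rule x)
      show "0 = f y" if "y \<in> - ?K" for y
        by (rule zero[symmetric]) (use that in \<open>rule ComplD\<close>)
    qed
    from grad_eq[OF this] show "grad f x = 0"
      by simp
  qed
qed

section \<open>Networks and coefficients\<close>

lemma dim_vec_net_eval:
  "\<theta> \<noteq> [] \<Longrightarrow> (\<And>w b. (w, b) \<in> set \<theta> \<Longrightarrow> dim_row w = dim_vec b) \<Longrightarrow>
    dim_vec (net_eval \<sigma> \<theta> v) = dim_vec (snd (last \<theta>))"
proof (induction \<theta> arbitrary: v)
  case (Cons wb \<theta>)
  obtain w b where "wb = (w, b)" by (cases wb)
  with Cons show ?case by (cases \<theta>) auto
qed simp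

text \<open>Induction over the layers. The input is an arbitrary vector-valued map \<open>v\<close>
  of dimension \<open>d\<close>, because the output of the first layer becomes the input of the
  remaining ones. The range conditions on indices matter: entries outside a vector have no specified
  value.\<close>

lemma net_eval_differentiable:
  fixes v :: "'a::real_normed_vector \<Rightarrow> real Matrix.vec"
  assumes \<sigma>: "\<And>r. \<sigma> differentiable (at r)"
    and "\<And>w b. (w, b) \<in> set \<theta> \<Longrightarrow> dim_row w = dim_vec b"
    and "\<And>y. dim_vec (v y) = d"
    and "\<And>i y. i < d \<Longrightarrow> (\<lambda>y. vec_index (v y) i) differentiable (at y)"
    and "\<And>y. i < dim_vec (net_eval \<sigma> \<theta> (v y))"
  shows "(\<lambda>y. vec_index (net_eval \<sigma> \<theta> (v y)) i) differentiable (at y)"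
  using assms(2-)
proof (induction \<theta> arbitrary: v d)
  case Nil
  then show ?case by auto
next
  case (Cons wb \<theta>)
  obtain w b where wb: "wb = (w, b)" by (cases wb)
  have dim: "dim_row w = dim_vec b" using Cons.prems(1) wb by simp
  have affine: "(\<lambda>y. vec_index (w *\<^sub>v v y + b) j) differentiable (at y)" if "j < dim_vec b" for j y
  proof -
    have "vec_index (w *\<^sub>v v y + b) j = (\<Sum>l\<in>{0..<d}. vec_index (row w j) l * vec_index (v y) l) + vec_index b j" for y
      using that dim Cons.prems(2) by (simp add: scalar_prod_def)
    then show ?thesis
      by (simp only:) (intro differentiable_add differentiable_sum differentiable_mult differentiable_const,
          use Cons.prems(3) in auto)
  qed
  show ?case
  proof (cases "\<theta> = []")
    case True
    then show ?thesis using affine Cons.prems(4) wb by simp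
  next
    case False
    then have eq: "net_eval \<sigma> (wb # \<theta>) y = net_eval \<sigma> \<theta> (map_vec \<sigma> (w *\<^sub>v y + b))" for y
      by (cases \<theta>) (auto simp: wb)
    show ?thesis
      unfolding eq
    proof (rule Cons.IH)
      show "dim_row w' = dim_vec b'" if "(w', b') \<in> set \<theta>" for w' b'
        using Cons.prems(1) that by simp
      show "dim_vec (map_vec \<sigma> (w *\<^sub>v v y + b)) = dim_vec b" for y by simp
      show "i < dim_vec (net_eval \<sigma> \<theta> (map_vec \<sigma> (w *\<^sub>v v y + b)))" for y
        using Cons.prems(4) unfolding eq .
      fix j y assume j: "j < dim_vec b"
      then have "vec_index (map_vec \<sigma> (w *\<^sub>v v y + b)) j = \<sigma> (vec_index (w *\<^sub>v v y + b) j)" for y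
        by simp
      then show "(\<lambda>y. vec_index (map_vec \<sigma> (w *\<^sub>v v y + b)) j) differentiable (at y)"
        using differentiable_compose[OF \<sigma> affine[OF j]] by simp
    qed
  qed
qed

lemma network_differentiable:
  fixes u :: "'a::euclidean_space \<Rightarrow> real"
  assumes u: "u \<in> networks \<sigma> A" and A: "architecture n A" and \<sigma>: "smooth_on UNIV \<sigma>"
  shows "u differentiable (at y)"
proof -
  obtain \<theta> where \<theta>: "\<theta> \<in> parameters A" and eq: "u = (\<lambda>y. vec_index (net_eval \<sigma> \<theta> (coords y)) 0)"
    using u by (auto simp: networks_def)
  have len: "Suc (length \<theta>) = length A" and ne: "\<theta> \<noteq> []"
    using \<theta> A by (auto simp: parameters_def architecture_def)
  have dims: "fst (\<theta> ! i) \<in> carrier_mat (A ! Suc i) (A ! i)" "snd (\<theta> ! i) \<in> carrier_vec (A ! Suc i)"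
    if "i < length \<theta>" for i
    using \<theta> that by (auto simp: parameters_def)
  have layers: "dim_row w = dim_vec b" if wb: "(w, b) \<in> set \<theta>" for w b
  proof -
    obtain i where "i < length \<theta>" "\<theta> ! i = (w, b)"
      using wb by (auto simp: in_set_conv_nth)
    with dims[of i] show ?thesis by auto
  qed
  have "dim_vec (snd (last \<theta>)) = A ! length \<theta>"
    using dims[of "length \<theta> - 1"] ne by (simp add: last_conv_nth)
  \<comment> \<open>The list \<open>A\<close> has one entry more than \<theta>, so its entry at
    \<open>length \<theta>\<close> is the last width; this makes index 0 of the output
    legitimate.\<close>
  also have "\<dots> = 1"
    using A len by (simp add: architecture_def last_conv_nth) (metis diff_Suc_1 last_conv_nth list.size(3) nat.simps(3))
  finally have "dim_vec (net_eval \<sigma> \<theta> v) = 1" for v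
    using dim_vec_net_eval[OF ne layers] by simp
  moreover have "(\<lambda>y. vec_index (coords y) i) differentiable (at y)" if "i < DIM('a)" for i and y :: 'a
    using that by (simp add: coords_def)
  moreover have "\<sigma> differentiable (at r)" for r
    using \<sigma> unfolding smooth_on_def by (metis Ck_on.simps(2) UNIV_I differentiable_on_def)
  ultimately show ?thesis
    unfolding eq by (intro net_eval_differentiable[where d = "DIM('a)"] layers) (auto simp: coords_def)
qed

lemma C2_derivative:
  fixes F f :: "real \<Rightarrow> 'a::euclidean_space"
  assumes F: "Ck_on 2 UNIV F" and f: "\<And>v. (F has_vector_derivative f v) (at v)"
  shows "(f has_vector_derivative vector_derivative f (at v)) (at v)"
    and "continuous_on UNIV (\<lambda>v. vector_derivative f (at v))"
proof -
  have partial_eq: "partial UNIV 1 g v = d" if "(g has_vector_derivative d) (at v)"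
    for g :: "real \<Rightarrow> 'a" and d v
    using frechet_derivative_at[OF that[unfolded has_vector_derivative_def]]
    unfolding partial_def by (metis scaleR_one)
  have "Ck_on (Suc (Suc 0)) UNIV F"
    using F by (simp add: numeral_2_eq_2)
  moreover have "partial UNIV 1 F = f"
    using partial_eq[OF f] by blast
  ultimately have C1: "f differentiable_on UNIV" "continuous_on UNIV (partial UNIV 1 f)"
    by auto
  then show f': "(f has_vector_derivative vector_derivative f (at v)) (at v)" for v
    by (simp add: differentiable_on_def vector_derivative_works)
  then have "partial UNIV 1 f = (\<lambda>v. vector_derivative f (at v))"
    using partial_eq by blast
  with C1 show "continuous_on UNIV (\<lambda>v. vector_derivative f (at v))"
    by simp
qed

section \<open>The speed on balls of states: boundedness and Lipschitz constants\<close>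

lemma ball0_ennreal: "0 \<le> r \<Longrightarrow> ball0 (ennreal r) = ball 0 r" and ball0_top: "ball0 \<infinity> = UNIV"
  by (auto simp: ball0_def ennreal_less_iff)

lemma open_convex_ball0: "open (ball0 \<rho>)" "convex (ball0 \<rho>)"
  by (cases \<rho>; simp add: ball0_ennreal ball0_top[simplified])+

lemma bounded_on_ennreal_ball:
  fixes f :: "real \<Rightarrow> 'a::real_normed_vector"
  assumes f: "continuous_on UNIV f" and \<rho>: "\<rho> < \<infinity>"
  obtains B where "0 \<le> B" "\<And>r. ennreal \<bar>r\<bar> \<le> \<rho> \<Longrightarrow> norm (f r) \<le> B"
proof -
  obtain c where c: "0 \<le> c" "\<rho> = ennreal c" using \<rho> by (cases \<rho>) auto
  have "compact (f ` cball 0 c)"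
    by (intro compact_continuous_image continuous_on_subset[OF f]) auto
  then have "bounded (f ` cball 0 c)" by (rule compact_imp_bounded)
  then obtain B where "0 < B" "\<forall>r\<in>cball 0 c. norm (f r) \<le> B"
    by (auto simp only: bounded_pos ball_simps)
  with c show ?thesis by (intro that[of B]) auto
qed

lemma Linf_norm_ball0_finite:
  fixes f :: "real \<Rightarrow> 'a::euclidean_space"
  assumes f: "continuous_on UNIV f" and \<rho>: "\<rho> < \<infinity>"
  shows "Linf_norm (ball0 \<rho>) f < \<infinity>"
proof -
  obtain B where "\<And>r. ennreal \<bar>r\<bar> \<le> \<rho> \<Longrightarrow> norm (f r) \<le> B"
    by (rule bounded_on_ennreal_ball[OF f \<rho>]) blast
  then have "Linf_norm (ball0 \<rho>) f \<le> ennreal B"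
    by (intro Linf_norm_le continuous_on_subset[OF f] ennreal_leI)
      (auto simp: borel_open open_convex_ball0, simp add: ball0_def)
  then show ?thesis by (simp add: order_le_less_trans)
qed

text \<open>The norm controls \<open>f'\<close> on the open ball only, whereas the state bounds are
  not strict and allow \<open>a\<close> and \<open>b\<close> on its boundary. Both points are scaled
  by \<kappa> < 1 into the ball, and \<kappa> tends to 1. For \<rho> = 0 the ball is empty, but then
  \<open>a\<close> and \<open>b\<close> are both 0.\<close>

lemma lipschitz_ball0:
  fixes f :: "real \<Rightarrow> 'a::euclidean_space"
  assumes f: "\<And>v. (f has_vector_derivative f' v) (at v)" and f': "continuous_on UNIV f'"
    and L: "0 \<le> L" "Linf_norm (ball0 \<rho>) f' \<le> ennreal L"
    and ab: "ennreal \<bar>a\<bar> \<le> \<rho>" "ennreal \<bar>b\<bar> \<le> \<rho>"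
  shows "norm (f a - f b) \<le> L * \<bar>a - b\<bar>"
proof (cases "\<rho> = 0")
  case True
  then show ?thesis using ab by simp
next
  case False
  have bound: "norm (f' v) \<le> L" if "v \<in> ball0 \<rho>" for v
  proof -
    have "ennreal (norm (f' v)) \<le> Linf_norm (ball0 \<rho>) f'"
      by (rule Linf_norm_ge[OF open_convex_ball0(1) subset_refl _ continuous_on_subset[OF f'] that])
        (auto simp: borel_open open_convex_ball0)
    then show ?thesis using L by (metis ennreal_le_iff order_trans)
  qed
  have lip: "norm (f c - f d) \<le> L * \<bar>c - d\<bar>" if "c \<in> ball0 \<rho>" "d \<in> ball0 \<rho>" for c d
  proof -
    have "norm (f c - f d) \<le> L * norm (c - d)"
    proof (rule differentiable_bound[OF open_convex_ball0(2)])
      show "(f has_derivative (\<lambda>k. k *\<^sub>R f' v)) (at v within ball0 \<rho>)" for v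
        using f by (auto simp: has_vector_derivative_def intro: has_derivative_at_withinI)
      show "onorm (\<lambda>k. k *\<^sub>R f' v) \<le> L" if "v \<in> ball0 \<rho>" for v
        using bound[OF that] by (intro onorm_le) (simp add: mult.commute[of L] mult_left_mono)
    qed (use that in auto)
    then show ?thesis by simp
  qed
  have scale: "\<kappa> * c \<in> ball0 \<rho>" if "0 < \<kappa>" "\<kappa> < 1" "ennreal \<bar>c\<bar> \<le> \<rho>" for \<kappa> c
  proof (cases "c = 0")
    case True
    then show ?thesis using \<open>\<rho> \<noteq> 0\<close> by (simp add: ball0_def zero_less_iff_neq_zero)
  next
    case False
    then have "\<bar>\<kappa> * c\<bar> < \<bar>c\<bar>" using that by (simp add: abs_mult)
    then have "ennreal \<bar>\<kappa> * c\<bar> < ennreal \<bar>c\<bar>" by (simp add: ennreal_less_iff)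
    then show ?thesis using that by (auto simp: ball0_def)
  qed
  have f_cont: "continuous_on UNIV f"
    using f by (meson continuous_at_imp_continuous_on has_vector_derivative_continuous)
  have "norm (f (1 * a) - f (1 * b)) - L * \<bar>1 * a - 1 * b\<bar> \<le> 0"
  proof (rule continuous_le_on_closure[where S = "{0<..<1}" and
        f = "\<lambda>\<kappa>. norm (f (\<kappa> * a) - f (\<kappa> * b)) - L * \<bar>\<kappa> * a - \<kappa> * b\<bar>" and x = 1])
    show "continuous_on (closure {0<..<1}) (\<lambda>\<kappa>. norm (f (\<kappa> * a) - f (\<kappa> * b)) - L * \<bar>\<kappa> * a - \<kappa> * b\<bar>)"
      by (intro continuous_intros continuous_on_compose2[OF f_cont]) auto
    show "norm (f (\<kappa> * a) - f (\<kappa> * b)) - L * \<bar>\<kappa> * a - \<kappa> * b\<bar> \<le> 0" if "\<kappa> \<in> {0<..<1}" for \<kappa>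
      using lip[OF scale[of \<kappa> a] scale[of \<kappa> b]] that ab by simp
  qed simp
  then show ?thesis by simp
qed

text \<open>Viewing \<open>coeff_a\<close> and \<open>coeff_b\<close> as components of a single
  vector integral gives Euclidean bounds from the norm of \<open>f\<close>, without a constant
  depending on the dimension.\<close>

lemma coeff_eq_integral:
  fixes f :: "real \<Rightarrow> (real^'n) \<times> real"
  assumes f: "continuous_on UNIV f"
  defines "v \<equiv> \<lambda>u z x' t s. u Minus ((x', z), t) + s * (u Plus ((x', z), t) - u Minus ((x', z), t))"
  shows "coeff_a f u z x' t = fst (integral {0..1} (\<lambda>s. f (v u z x' t s)))"
    and "coeff_b f u z x' t = snd (integral {0..1} (\<lambda>s. f (v u z x' t s)))"
proof -
  have int: "(\<lambda>s. f (v u z x' t s)) integrable_on {0..1}"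
    unfolding v_def
    by (intro integrable_continuous_real continuous_on_compose2[OF f] continuous_intros) auto
  show "coeff_b f u z x' t = snd (integral {0..1} (\<lambda>s. f (v u z x' t s)))"
    using integral_linear[OF int bounded_linear_snd]
    by (simp add: coeff_b_def segment_mean_def v_def o_def)
  have "integral {0..1} (\<lambda>s. vec_nth (fst (f (v u z x' t s))) i)
      = vec_nth (fst (integral {0..1} (\<lambda>s. f (v u z x' t s)))) i" for i
    using integral_linear[OF int bounded_linear_compose[OF bounded_linear_vec_nth bounded_linear_fst]]
    by (simp add: o_def)
  then show "coeff_a f u z x' t = fst (integral {0..1} (\<lambda>s. f (v u z x' t s)))"
    by (simp add: coeff_a_def segment_mean_def v_def Finite_Cartesian_Product.vec_eq_iff)
qed

text \<open>Here \<open>d\<close> stands for the gradient of \<open>g\<close>. The differences of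
  both coefficients are projections of one vector \<open>?D\<close>, so each is at most its norm;
  the summand 1 belongs to \<open>coeff_b\<close> and \<open>norm d\<close> to
  \<open>coeff_a\<close>. Convexity of \<open>W\<close> keeps the whole segment between the two
  states where \<open>f\<close> is controlled.\<close>

lemma coeff_bounds:
  fixes f :: "real \<Rightarrow> (real^'n) \<times> real"
  assumes f: "continuous_on UNIV f" and W: "convex W"
    and UW: "\<And>s. U s ((x', z), t) \<in> W"
    and B: "\<And>r. r \<in> W \<Longrightarrow> norm (f r) \<le> B"
  shows "norm (coeff_a f U z x' t) \<le> B"
    and "(\<And>s. u s ((x', z'), t) \<in> W) \<Longrightarrow> 0 \<le> L \<Longrightarrow>
      (\<And>r r'. r \<in> W \<Longrightarrow> r' \<in> W \<Longrightarrow> norm (f r - f r') \<le> L * \<bar>r - r'\<bar>) \<Longrightarrow>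
      \<bar>coeff_b f U z x' t - coeff_b f u z' x' t - inner (coeff_a f U z x' t - coeff_a f u z' x' t) d\<bar>
        \<le> (1 + norm d) * (L * (\<bar>U Plus ((x', z), t) - u Plus ((x', z'), t)\<bar>
            + \<bar>U Minus ((x', z), t) - u Minus ((x', z'), t)\<bar>))"
proof -
  define v where "v u z s = u Minus ((x', z), t) + s * (u Plus ((x', z), t) - u Minus ((x', z), t))"
    for u :: "pm \<Rightarrow> ((real^'n) \<times> real) \<times> real \<Rightarrow> real" and z s :: real
  define M where "M u z = integral {0..1} (\<lambda>s. f (v u z s))" for u z
  have coeff: "coeff_a f u z x' t = fst (M u z)" "coeff_b f u z x' t = snd (M u z)" for u z
    unfolding M_def v_def by (rule coeff_eq_integral[OF f])+
  have int: "(\<lambda>s. f (v u z s)) integrable_on {0..1}" for u z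
    unfolding v_def
    by (intro integrable_continuous_real continuous_on_compose2[OF f] continuous_intros) auto
  have vW: "v u z s \<in> W" if "\<And>s. u s ((x', z), t) \<in> W" "s \<in> {0..1}" for u z s
    using convexD_alt[OF W that(1) that(1), of s Minus Plus] that(2) by (simp add: v_def algebra_simps)
  have bound: "norm (integral {0..1} k) \<le> c"
    if "k integrable_on {0..1}" "\<And>s. s \<in> {0..1} \<Longrightarrow> norm (k s) \<le> c"
    for k :: "real \<Rightarrow> (real^'n) \<times> real" and c
    using integral_norm_bound_integral[OF that(1) integrable_const_ivl[of c 0 1]] that(2) by simp
  have "norm (M U z) \<le> B"
    unfolding M_def by (intro bound int B vW UW)
  then show "norm (coeff_a f U z x' t) \<le> B"
    unfolding coeff using norm_fst_le[of "fst (M U z)" "snd (M U z)"] by simp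
  assume uW: "\<And>s. u s ((x', z'), t) \<in> W" and L: "0 \<le> L"
    and lip: "\<And>r r'. r \<in> W \<Longrightarrow> r' \<in> W \<Longrightarrow> norm (f r - f r') \<le> L * \<bar>r - r'\<bar>"
  let ?p = "U Plus ((x', z), t) - u Plus ((x', z'), t)" and ?m = "U Minus ((x', z), t) - u Minus ((x', z'), t)"
  let ?D = "M U z - M u z'"
  have "norm ?D \<le> L * (\<bar>?p\<bar> + \<bar>?m\<bar>)"
    unfolding M_def integral_diff[OF int int, symmetric]
  proof (rule bound)
    fix s :: real assume s: "s \<in> {0..1}"
    have "norm (f (v U z s) - f (v u z' s)) \<le> L * \<bar>v U z s - v u z' s\<bar>"
      by (intro lip vW UW uW s)
    also have "\<bar>v U z s - v u z' s\<bar> \<le> \<bar>?p\<bar> + \<bar>?m\<bar>"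
    proof -
      have "v U z s - v u z' s = s * ?p + (1 - s) * ?m" by (simp add: v_def algebra_simps)
      moreover have "\<bar>s * ?p\<bar> \<le> \<bar>?p\<bar>" "\<bar>(1 - s) * ?m\<bar> \<le> \<bar>?m\<bar>"
        using s by (auto simp: abs_mult mult_left_le_one_le)
      ultimately show ?thesis by linarith
    qed
    finally show "norm (f (v U z s) - f (v u z' s)) \<le> L * (\<bar>?p\<bar> + \<bar>?m\<bar>)"
      using L by (simp add: mult_left_mono)
  qed (intro integrable_diff int)
  moreover have "\<bar>snd ?D - inner (fst ?D) d\<bar> \<le> (1 + norm d) * norm ?D"
  proof -
    have "\<bar>snd ?D\<bar> \<le> norm ?D" "norm (fst ?D) \<le> norm ?D"
      using norm_fst_le[of "fst ?D" "snd ?D"] norm_snd_le[of "snd ?D" "fst ?D"]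
      unfolding prod.collapse real_norm_def by - assumption+
    moreover from this have "\<bar>inner (fst ?D) d\<bar> \<le> norm ?D * norm d"
      by (intro order_trans[OF Cauchy_Schwarz_ineq2] mult_right_mono) auto
    ultimately show ?thesis by (simp add: algebra_simps)
  qed
  ultimately show "\<bar>coeff_b f U z x' t - coeff_b f u z' x' t - inner (coeff_a f U z x' t - coeff_a f u z' x' t) d\<bar>
        \<le> (1 + norm d) * (L * (\<bar>?p\<bar> + \<bar>?m\<bar>))"
    unfolding coeff fst_diff[symmetric] snd_diff[symmetric]
    by (elim order_trans, intro mult_left_mono) auto
qed

section \<open>Error estimates\<close>

lemma L_i_has_derivative:
  assumes "(u has_derivative D) (at (x, t))"
  shows "D (f (u (x, t)), 1) = L_i f u (x, t)"
  using has_derivative_space_grad(3)[OF assms] by (simp add: L_i_def)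

lemma K_i_has_derivative:
  assumes "(h has_derivative D) (at (x, t))"
  shows "D (coeff_a f u (h (x, t)) x t, 1) = K_i f u h (x, t) + coeff_b f u (h (x, t)) x t"
  using has_derivative_space_grad(3)[OF assms] by (simp add: K_i_def)

text \<open>Along the speed f(U), the equation for U - u has the source \<open>L_i f U\<close> minus
  (f(U) - f(u)) . \<nabla>u. The second term is at most \<open>L * P\<close> times the error itself,
  which gives the exponential rate.\<close>

lemma state_error:
  fixes f :: "real \<Rightarrow> 'a::euclidean_space" and u U :: "'a \<times> real \<Rightarrow> real"
  assumes U: "\<And>p. U differentiable (at p)" and u: "classical_solution T f u0 u"
    and W: "\<And>x t. 0 < t \<Longrightarrow> t < T \<Longrightarrow> U (x, t) \<in> W \<and> u (x, t) \<in> W"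
    and B: "\<And>r. r \<in> W \<Longrightarrow> norm (f r) \<le> B" "0 \<le> B"
    and L: "0 \<le> L" "\<And>r r'. r \<in> W \<Longrightarrow> r' \<in> W \<Longrightarrow> norm (f r - f r') \<le> L * \<bar>r - r'\<bar>"
    and P: "0 \<le> P" "\<And>x t. 0 < t \<Longrightarrow> t < T \<Longrightarrow> norm (space_grad u (x, t)) \<le> P"
    and Ei: "0 \<le> Ei" "\<And>x t. 0 < t \<Longrightarrow> t < T \<Longrightarrow> \<bar>L_i f U (x, t)\<bar> \<le> Ei"
    and Eb: "0 \<le> Eb" "\<And>x. \<bar>L_b u0 U x\<bar> \<le> Eb"
    and t: "0 \<le> t" "t < T"
  shows "\<bar>U (x, t) - u (x, t)\<bar> \<le> (Eb + t * Ei) * exp (t * (L * P))"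
proof -
  have C1: "Ck_on 1 (UNIV \<times> {0..T}) u" and init: "\<And>x. u (x, 0) = u0 x"
    and pde: "\<And>x t. 0 < t \<Longrightarrow> t < T \<Longrightarrow> L_i f u (x, t) = 0"
    using u by (auto simp: classical_solution_def)
  have U_cont: "continuous_on S U" for S
    by (intro differentiable_imp_continuous_on differentiable_at_imp_differentiable_on U)
  have "\<omega> * (U (x, t) - u (x, t)) \<le> (Eb + t * Ei) * exp (t * (L * P))" if \<omega>: "\<bar>\<omega>\<bar> = 1" for \<omega>
  proof (rule transport_max_principle[where w = "\<lambda>p. \<omega> * (U p - u p)" and B = B])
    show "continuous_on (UNIV \<times> {0..t}) (\<lambda>p. \<omega> * (U p - u p))"
      by (intro continuous_intros U_cont continuous_on_subset[OF Ck_on_1_slab(1)[OF C1]]) (use t in auto)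
    show "\<omega> * (U (y, 0) - u (y, 0)) \<le> Eb" for y
      using Eb(2)[of y] \<omega> init by (auto simp: L_b_def abs_if split: if_splits)
    fix y s assume "0 < s" "s \<le> t" and nonneg: "0 \<le> \<omega> * (U (y, s) - u (y, s))"
    with t have s: "0 < s" "s < T" by auto
    \<comment> \<open>The maximum principle asks only about points where the signed error is
      nonnegative. There it equals the absolute error, so a bound in terms of |U - u| becomes linear
      in the test function.\<close>
    have abs_eq: "\<bar>U (y, s) - u (y, s)\<bar> = \<omega> * (U (y, s) - u (y, s))"
      using nonneg \<omega> by (metis abs_mult abs_of_nonneg mult_1)
    obtain DU where DU: "(U has_derivative DU) (at (y, s))"
      using U unfolding differentiable_def by blast
    obtain Du where Du: "(u has_derivative Du) (at (y, s))"
      using Ck_on_1_slab(2)[OF C1 s] by blast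
    let ?V = "f (U (y, s))"
    let ?D = "\<lambda>k. \<omega> * (DU k - Du k)"
    have "Du (?V, 1) = Du (f (u (y, s)), 1) + Du (?V - f (u (y, s)), 0)"
      using linear_add[OF has_derivative_linear[OF Du], of "(f (u (y, s)), 1)" "(?V - f (u (y, s)), 0)"]
      by simp
    also have "\<dots> = inner (?V - f (u (y, s))) (space_grad u (y, s))"
      using L_i_has_derivative[OF Du] pde[OF s] has_derivative_space_grad(2)[OF Du] by simp
    finally have "DU (?V, 1) - Du (?V, 1) = L_i f U (y, s) - inner (?V - f (u (y, s))) (space_grad u (y, s))"
      using L_i_has_derivative[OF DU] by simp
    moreover have "\<bar>inner (?V - f (u (y, s))) (space_grad u (y, s))\<bar> \<le> L * \<bar>U (y, s) - u (y, s)\<bar> * P"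
      by (intro order_trans[OF Cauchy_Schwarz_ineq2] mult_mono L(2) P mult_nonneg_nonneg)
        (use W[OF s] L s in auto)
    ultimately have "\<bar>?D (?V, 1)\<bar> \<le> L * P * (\<omega> * (U (y, s) - u (y, s))) + Ei"
      unfolding abs_mult \<omega> abs_eq[symmetric] using Ei(2)[OF s, of y] by (simp add: mult_ac)
    moreover have "((\<lambda>p. \<omega> * (U p - u p)) has_derivative ?D) (at (y, s))"
      by (intro has_derivative_mult_right has_derivative_diff DU Du)
    moreover have "norm ?V \<le> B"
      using B(1) W[OF s] by blast
    ultimately show "\<exists>D V. ((\<lambda>p. \<omega> * (U p - u p)) has_derivative D) (at (y, s)) \<and> norm V \<le> B \<and>
        D (V, 1) \<le> L * P * (\<omega> * (U (y, s) - u (y, s))) + Ei"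
      by (meson abs_le_D1)
  qed (use B L P Ei Eb t in auto)
  from this[of 1] this[of "-1"] show ?thesis by simp
qed

text \<open>A finite norm serves as \<open>G\<close> itself. An infinite norm dominates every real
  number, so any bound from compactness will do. The infinite case is relevant, since the factor 1 +
  \<infinity> may be multiplied by 0 in the final estimate.\<close>

lemma gradient_bound_on_compact:
  fixes g :: "'a::euclidean_space \<times> real \<Rightarrow> real"
  assumes g: "Ck_on 1 (UNIV \<times> {0..T}) g" and K: "compact K" "K \<subseteq> UNIV \<times> {0..T}"
  obtains G where "0 \<le> G" "ennreal G \<le> Linf_norm (UNIV \<times> {0..T}) (space_grad g)"
    "\<And>x t. (x, t) \<in> K \<Longrightarrow> 0 < t \<Longrightarrow> t < T \<Longrightarrow> norm (space_grad g (x, t)) \<le> G"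
proof -
  obtain \<gamma> where \<gamma>: "continuous_on (UNIV \<times> {0..T}) \<gamma>"
    and eq: "\<And>x t. 0 < t \<Longrightarrow> t < T \<Longrightarrow> space_grad g (x, t) = \<gamma> (x, t)"
    using Ck_on_1_slab(3)[OF g] by blast
  show ?thesis
  proof (cases "Linf_norm (UNIV \<times> {0..T}) (space_grad g)")
    case (real G)
    show ?thesis
    proof (rule that[of G])
      fix x :: 'a and t :: real assume "0 < t" "t < T"
      with slab_Linf_norm_ge[OF Ck_on_1_slab(4)[OF g] this, of x] real
      show "norm (space_grad g (x, t)) \<le> G" by simp
    qed (use real in auto)
  next
    case top
    have "compact (\<gamma> ` K)"
      by (intro compact_continuous_image continuous_on_subset[OF \<gamma>] K)
    then have "bounded (\<gamma> ` K)" by (rule compact_imp_bounded)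
    then obtain G where G: "0 < G" "\<forall>p\<in>K. norm (\<gamma> p) \<le> G"
      by (auto simp only: bounded_pos ball_simps)
    show ?thesis
      by (rule that[of G]) (use G top eq in auto)
  qed
qed

text \<open>The bound \<open>G\<close> depends on the cone below \<open>(x, t)\<close>: it exists even if the gradient of \<open>g\<close> is unbounded.\<close>

lemma interface_error:
  fixes f :: "real \<Rightarrow> (real^'n) \<times> real"
    and u U :: "pm \<Rightarrow> ((real^'n) \<times> real) \<times> real \<Rightarrow> real"
    and g h :: "(real^'n) \<times> real \<Rightarrow> real"
  assumes f: "continuous_on UNIV f" and W: "convex W"
    and inW: "\<And>s x t. 0 < t \<Longrightarrow> t < T \<Longrightarrow> U s (x, t) \<in> W \<and> u s (x, t) \<in> W"
    and B: "\<And>r. r \<in> W \<Longrightarrow> norm (f r) \<le> B" "0 \<le> B"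
    and L: "0 \<le> L" "\<And>r r'. r \<in> W \<Longrightarrow> r' \<in> W \<Longrightarrow> norm (f r - f r') \<le> L * \<bar>r - r'\<bar>"
    and M: "\<And>s. 0 \<le> M s" "\<And>s x t. 0 < t \<Longrightarrow> t < T \<Longrightarrow> L * \<bar>U s (x, t) - u s (x, t)\<bar> \<le> M s"
    and N: "\<And>s. 0 \<le> N s"
      "\<And>s x z z' t. 0 < t \<Longrightarrow> t < T \<Longrightarrow> L * \<bar>u s ((x, z), t) - u s ((x, z'), t)\<bar> \<le> N s * \<bar>z - z'\<bar>"
    and h: "\<And>p. h differentiable (at p)" and g: "interface_solution T f u g0 g"
    and Si: "0 \<le> Si" "\<And>x t. 0 < t \<Longrightarrow> t < T \<Longrightarrow> \<bar>K_i f U h (x, t)\<bar> \<le> Si"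
    and Sb: "0 \<le> Sb" "\<And>x. \<bar>K_b g0 h x\<bar> \<le> Sb"
    and t: "0 \<le> t" "t < T"
  obtains G where "0 \<le> G" "ennreal G \<le> Linf_norm (UNIV \<times> {0..T}) (space_grad g)"
    "\<bar>h (x, t) - g (x, t)\<bar> \<le> (Sb + t * (Si + (1 + G) * (M Plus + M Minus)))
      * exp (t * ((1 + G) * (N Plus + N Minus)))"
proof -
  have C1: "Ck_on 1 (UNIV \<times> {0..T}) g" and init: "\<And>x. g (x, 0) = g0 x"
    and pde: "\<And>x t. 0 < t \<Longrightarrow> t < T \<Longrightarrow> K_i f u g (x, t) = 0"
    using g by (auto simp: interface_solution_def)
  have h_cont: "continuous_on S h" for S
    by (intro differentiable_imp_continuous_on differentiable_at_imp_differentiable_on h)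
  \<comment> \<open>This cylinder contains the whole backward cone below (x, t).\<close>
  have "compact (cball x (B * t) \<times> {0..t})" "cball x (B * t) \<times> {0..t} \<subseteq> UNIV \<times> {0..T}"
    using t by (auto intro: compact_Times)
  from gradient_bound_on_compact[OF C1 this]
  obtain G where G: "0 \<le> G" "ennreal G \<le> Linf_norm (UNIV \<times> {0..T}) (space_grad g)"
    and G_le: "\<And>y s. (y, s) \<in> cball x (B * t) \<times> {0..t} \<Longrightarrow> 0 < s \<Longrightarrow> s < T \<Longrightarrow>
      norm (space_grad g (y, s)) \<le> G"
    by blast
  define c where "c = (1 + G) * (N Plus + N Minus)"
  define d where "d = Si + (1 + G) * (M Plus + M Minus)"
  have cd: "0 \<le> c" "0 \<le> d" using G M N Si by (simp_all add: c_def d_def)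
  have "\<omega> * (h (x, t) - g (x, t)) \<le> (Sb + t * d) * exp (t * c)" if \<omega>: "\<bar>\<omega>\<bar> = 1" for \<omega>
  proof (rule transport_max_principle[where w = "\<lambda>p. \<omega> * (h p - g p)" and B = B])
    show "continuous_on (UNIV \<times> {0..t}) (\<lambda>p. \<omega> * (h p - g p))"
      by (intro continuous_intros h_cont continuous_on_subset[OF Ck_on_1_slab(1)[OF C1]]) (use t in auto)
    show "\<omega> * (h (y, 0) - g (y, 0)) \<le> Sb" for y
      using Sb(2)[of y] \<omega> init by (auto simp: K_b_def abs_if split: if_splits)
    fix y s assume st: "0 < s" "s \<le> t" and cone: "norm (y - x) \<le> B * (t - s)"
      and nonneg: "0 \<le> \<omega> * (h (y, s) - g (y, s))"
    with t have s: "0 < s" "s < T" by auto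
    have "B * (t - s) \<le> B * t" using B st by (simp add: mult_left_mono)
    with cone st have "(y, s) \<in> cball x (B * t) \<times> {0..t}"
      by (simp add: dist_norm norm_minus_commute)
    note G_le = G_le[OF this s]
    have abs_eq: "\<bar>h (y, s) - g (y, s)\<bar> = \<omega> * (h (y, s) - g (y, s))"
      using nonneg \<omega> by (metis abs_mult abs_of_nonneg mult_1)
    obtain Dh where Dh: "(h has_derivative Dh) (at (y, s))"
      using h unfolding differentiable_def by blast
    obtain Dg where Dg: "(g has_derivative Dg) (at (y, s))"
      using Ck_on_1_slab(2)[OF C1 s] by blast
    let ?z = "h (y, s)" and ?z' = "g (y, s)"
    let ?V = "coeff_a f U ?z y s" and ?a = "coeff_a f u ?z' y s"
    let ?D = "\<lambda>k. \<omega> * (Dh k - Dg k)"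
    let ?diff = "coeff_b f U ?z y s - coeff_b f u ?z' y s - inner (?V - ?a) (space_grad g (y, s))"
    have "Dg (?V, 1) = Dg (?a, 1) + Dg (?V - ?a, 0)"
      using linear_add[OF has_derivative_linear[OF Dg], of "(?a, 1)" "(?V - ?a, 0)"] by simp
    also have "\<dots> = coeff_b f u ?z' y s + inner (?V - ?a) (space_grad g (y, s))"
      using K_i_has_derivative[OF Dg] pde[OF s] has_derivative_space_grad(2)[OF Dg] by simp
    finally have D_eq: "Dh (?V, 1) - Dg (?V, 1) = K_i f U h (y, s) + ?diff"
      using K_i_has_derivative[OF Dh] by simp
    \<comment> \<open>The state \<open>u\<close> at the height of \<open>h\<close> is inserted: the
      first difference is a state error at one point, the second the variation of \<open>u\<close>
      between the two heights.\<close>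
    have "L * \<bar>U r ((y, ?z), s) - u r ((y, ?z'), s)\<bar> \<le> M r + N r * \<bar>?z - ?z'\<bar>" for r
    proof -
      have "L * \<bar>U r ((y, ?z), s) - u r ((y, ?z'), s)\<bar>
          \<le> L * (\<bar>U r ((y, ?z), s) - u r ((y, ?z), s)\<bar> + \<bar>u r ((y, ?z), s) - u r ((y, ?z'), s)\<bar>)"
        using L by (intro mult_left_mono) auto
      also have "\<dots> \<le> M r + N r * \<bar>?z - ?z'\<bar>"
        unfolding distrib_left by (intro add_mono M(2) N(2) s)
      finally show ?thesis .
    qed
    from this[of Plus] this[of Minus]
    have "L * (\<bar>U Plus ((y, ?z), s) - u Plus ((y, ?z'), s)\<bar> + \<bar>U Minus ((y, ?z), s) - u Minus ((y, ?z'), s)\<bar>)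
        \<le> (M Plus + M Minus) + (N Plus + N Minus) * \<bar>?z - ?z'\<bar>"
      by (simp add: algebra_simps)
    moreover have "\<bar>?diff\<bar> \<le> (1 + norm (space_grad g (y, s))) *
        (L * (\<bar>U Plus ((y, ?z), s) - u Plus ((y, ?z'), s)\<bar> + \<bar>U Minus ((y, ?z), s) - u Minus ((y, ?z'), s)\<bar>))"
      by (rule coeff_bounds(2)[OF f W _ B(1)]) (use inW[OF s] L in auto)
    ultimately have "\<bar>?diff\<bar> \<le> (1 + G) * ((M Plus + M Minus) + (N Plus + N Minus) * \<bar>?z - ?z'\<bar>)"
      using G_le G L by (elim order_trans) (intro mult_mono, auto)
    also have "\<dots> = c * \<bar>?z - ?z'\<bar> + (d - Si)"
      by (simp add: c_def d_def algebra_simps)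
    finally have "\<bar>Dh (?V, 1) - Dg (?V, 1)\<bar> \<le> c * \<bar>?z - ?z'\<bar> + d"
      unfolding D_eq using Si(2)[OF s, of y] abs_triangle_ineq[of "K_i f U h (y, s)" ?diff] by linarith
    then have "?D (?V, 1) \<le> c * (\<omega> * (?z - ?z')) + d"
      unfolding abs_eq using abs_le_D1[of "?D (?V, 1)"] by (simp add: abs_mult \<omega>)
    moreover have "((\<lambda>p. \<omega> * (h p - g p)) has_derivative ?D) (at (y, s))"
      by (intro has_derivative_mult_right has_derivative_diff Dh Dg)
    moreover have "norm ?V \<le> B"
      by (rule coeff_bounds(1)[OF f W]) (use inW[OF s] B in auto)
    ultimately show "\<exists>D V. ((\<lambda>p. \<omega> * (h p - g p)) has_derivative D) (at (y, s)) \<and> norm V \<le> B \<and>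
        D (V, 1) \<le> c * (\<omega> * (h (y, s) - g (y, s))) + d"
      by blast
  qed (use B Sb cd t in auto)
  from this[of 1] this[of "-1"] have "\<bar>h (x, t) - g (x, t)\<bar> \<le> (Sb + t * d) * exp (t * c)"
    by simp
  then show ?thesis
    using that[OF G] unfolding c_def d_def by blast
qed

section \<open>Passage from real constants to norms in \<open>ennreal\<close>\<close>

lemma ennexp_ennreal: "0 \<le> r \<Longrightarrow> ennexp (ennreal r) = ennreal (exp r)"
  by (simp add: ennexp_def)

lemma ennexp_mono: "x \<le> y \<Longrightarrow> ennexp x \<le> ennexp y"
  by (cases x; cases y) (auto simp: ennexp_def top_unique intro: ennreal_leI)

lemma ennexp_ge_1: "1 \<le> ennexp x"
  by (cases x) (auto simp: ennexp_def)

text \<open>The bounds \<open>M\<close> and \<open>N\<close> include the factor \<open>L\<close>.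
  With \<open>L = 0\<close> both can be 0 even when U - u is unbounded, which is what the degenerate
  case of the final estimate requires.\<close>

lemma interface_error_Linf:
  fixes f :: "real \<Rightarrow> (real^'n) \<times> real"
    and u U :: "pm \<Rightarrow> ((real^'n) \<times> real) \<times> real \<Rightarrow> real"
    and g h :: "(real^'n) \<times> real \<Rightarrow> real"
  assumes T: "0 < T" "T \<le> 1" and f: "continuous_on UNIV f" and W: "convex W"
    and inW: "\<And>s x t. 0 < t \<Longrightarrow> t < T \<Longrightarrow> U s (x, t) \<in> W \<and> u s (x, t) \<in> W"
    and B: "\<And>r. r \<in> W \<Longrightarrow> norm (f r) \<le> B" "0 \<le> B"
    and L: "0 \<le> L" "\<And>r r'. r \<in> W \<Longrightarrow> r' \<in> W \<Longrightarrow> norm (f r - f r') \<le> L * \<bar>r - r'\<bar>"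
    and M: "\<And>s. 0 \<le> M s" "\<And>s x t. 0 < t \<Longrightarrow> t < T \<Longrightarrow> L * \<bar>U s (x, t) - u s (x, t)\<bar> \<le> M s"
    and N: "\<And>s. 0 \<le> N s"
      "\<And>s x z z' t. 0 < t \<Longrightarrow> t < T \<Longrightarrow> L * \<bar>u s ((x, z), t) - u s ((x, z'), t)\<bar> \<le> N s * \<bar>z - z'\<bar>"
    and h: "\<And>p. h differentiable (at p)" and g: "interface_solution T f u g0 g"
    and Si: "0 \<le> Si" "\<And>x t. 0 < t \<Longrightarrow> t < T \<Longrightarrow> \<bar>K_i f U h (x, t)\<bar> \<le> Si"
    and Sb: "0 \<le> Sb" "\<And>x. \<bar>K_b g0 h x\<bar> \<le> Sb"
  defines "G \<equiv> Linf_norm (UNIV \<times> {0..T}) (space_grad g)"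
  shows "Linf_norm (UNIV \<times> {0..T}) (\<lambda>y. h y - g y)
    \<le> (ennreal Sb + ennreal Si + (1 + G) * (ennreal (T * M Plus) + ennreal (T * M Minus)))
        * ennexp (ennreal T * ((1 + G) * (ennreal (N Plus) + ennreal (N Minus))))"
proof (rule slab_Linf_norm_le[OF T(1)])
  have "Ck_on 1 (UNIV \<times> {0..T}) g"
    using g by (simp add: interface_solution_def)
  then show "continuous_on (UNIV \<times> {0..T}) (\<lambda>y. h y - g y)"
    by (intro continuous_intros Ck_on_1_slab(1) differentiable_imp_continuous_on
        differentiable_at_imp_differentiable_on h)
  fix x :: "real^'n" and t :: real assume t: "0 < t" "t < T"
  obtain G' where G': "0 \<le> G'" "ennreal G' \<le> G"
    and le: "\<bar>h (x, t) - g (x, t)\<bar> \<le> (Sb + t * (Si + (1 + G') * (M Plus + M Minus)))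
      * exp (t * ((1 + G') * (N Plus + N Minus)))"
    by (rule interface_error[OF f W inW B L M N h g Si Sb, of t x]) (use t in \<open>auto simp: G_def\<close>)
  have "t * (Si + (1 + G') * (M Plus + M Minus)) \<le> T * (Si + (1 + G') * (M Plus + M Minus))"
    using t T G' M Si by (intro mult_right_mono) auto
  also have "\<dots> = T * Si + (1 + G') * (T * M Plus + T * M Minus)"
    by (simp add: algebra_simps)
  also have "\<dots> \<le> Si + (1 + G') * (T * M Plus + T * M Minus)"
    using T Si by (simp add: mult_left_le_one_le)
  finally have "\<bar>h (x, t) - g (x, t)\<bar> \<le> (Sb + Si + (1 + G') * (T * M Plus + T * M Minus))
      * exp (T * ((1 + G') * (N Plus + N Minus)))"
    using t T G' M N Si Sb
    by (intro order_trans[OF le] mult_mono) (auto intro!: mult_right_mono add_nonneg_nonneg mult_nonneg_nonneg)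
  then have "ennreal \<bar>h (x, t) - g (x, t)\<bar> \<le> ennreal ((Sb + Si + (1 + G') * (T * M Plus + T * M Minus))
      * exp (T * ((1 + G') * (N Plus + N Minus))))"
    by (rule ennreal_leI)
  also have "\<dots> = (ennreal Sb + ennreal Si + (1 + ennreal G') * (ennreal (T * M Plus) + ennreal (T * M Minus)))
        * ennexp (ennreal T * ((1 + ennreal G') * (ennreal (N Plus) + ennreal (N Minus))))"
    using T G' M N Si Sb
    by (simp add: ennexp_ennreal flip: ennreal_plus ennreal_1 ennreal_mult)
  \<comment> \<open>The real number \<open>G'\<close> varies with the point (x, t). Replacing it by
    \<open>G\<close> only here keeps the preceding arithmetic finite even for G =
    \<infinity>.\<close>
  also have "\<dots> \<le> (ennreal Sb + ennreal Si + (1 + G) * (ennreal (T * M Plus) + ennreal (T * M Minus)))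
        * ennexp (ennreal T * ((1 + G) * (ennreal (N Plus) + ennreal (N Minus))))"
    by (intro mult_mono add_mono ennexp_mono G') auto
  finally show "ennreal \<bar>h (x, t) - g (x, t)\<bar> \<le> \<dots>" .
qed

section \<open>A priori bounds for the states, and the origin of the constants\<close>

lemma convex_ennreal_ball: "convex {r. ennreal \<bar>r\<bar> \<le> \<rho>}"
proof (cases \<rho>)
  case (real c)
  then have "{r. ennreal \<bar>r\<bar> \<le> \<rho>} = cball 0 c" by auto
  then show ?thesis by simp
qed simp

text \<open>Along its own speed the state changes at a rate of at most \<open>E\<close>. The exact
  solution has E = 0, which yields \<rho>_0; a network has its interior residual as
  \<open>E\<close>, which yields the larger radius for networks.\<close>

lemma state_bound:
  fixes f :: "real \<Rightarrow> 'a::euclidean_space" and u :: "'a \<times> real \<Rightarrow> real"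
  assumes f: "continuous_on UNIV f" and cont: "continuous_on (UNIV \<times> {0..T}) u"
    and diff: "\<And>x t. 0 < t \<Longrightarrow> t < T \<Longrightarrow> u differentiable (at (x, t))"
    and init: "\<And>x. ennreal \<bar>u (x, 0)\<bar> \<le> m"
    and E: "\<And>x t. 0 < t \<Longrightarrow> t < T \<Longrightarrow> ennreal \<bar>L_i f u (x, t)\<bar> \<le> E"
    and t: "0 < t" "t < T"
  shows "ennreal \<bar>u (x, t)\<bar> \<le> m + ennreal T * E"
proof (cases "m + ennreal T * E = \<infinity>")
  case False
  \<comment> \<open>T > 0 is essential: with 0 * \<infinity> = 0, a vanishing factor would hide an
    infinite \<open>E\<close>.\<close>
  then have "m < \<infinity>" "E < \<infinity>"
    using t by (auto simp: ennreal_mult_eq_top_iff less_top)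
  then obtain m' E' where m': "0 \<le> m'" "m = ennreal m'" and E': "0 \<le> E'" "E = ennreal E'"
    by (cases m; cases E) auto
  have "\<bar>u (x, t)\<bar> \<le> m' + t * E'"
  proof (rule transport_bound[OF cont f])
    show "\<exists>D. (u has_derivative D) (at (y, s)) \<and> \<bar>D (f (u (y, s)), 1)\<bar> \<le> E'"
      if s: "0 < s" "s < T" for y s
    proof -
      obtain D where D: "(u has_derivative D) (at (y, s))"
        using diff[OF s] unfolding differentiable_def by blast
      moreover have "\<bar>L_i f u (y, s)\<bar> \<le> E'"
        using E[OF s, of y] E' by simp
      ultimately show ?thesis using L_i_has_derivative[OF D, of f] by auto
    qed
  qed (use init m' E' t in auto)
  also have "\<dots> \<le> m' + T * E'" using t E' by (simp add: mult_right_mono)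
  finally have "ennreal \<bar>u (x, t)\<bar> \<le> ennreal (m' + T * E')" by (rule ennreal_leI)
  also have "\<dots> = m + ennreal T * E" using m' E' t by (simp add: ennreal_mult)
  finally show ?thesis .
next
  case True
  then show ?thesis by (simp only: infinity_ennreal_def top_greatest)
qed

lemma classical_solution_bound:
  fixes f :: "real \<Rightarrow> 'a::euclidean_space" and u :: "'a \<times> real \<Rightarrow> real"
  assumes f: "continuous_on UNIV f" and u0: "continuous_on UNIV u0"
    and u: "classical_solution T f u0 u" and t: "0 < t" "t < T"
  shows "ennreal \<bar>u (x, t)\<bar> \<le> Linf_norm UNIV u0"
proof -
  have C1: "Ck_on 1 (UNIV \<times> {0..T}) u"
    using u by (simp add: classical_solution_def)
  have "ennreal \<bar>u (x, t)\<bar> \<le> Linf_norm UNIV u0 + ennreal T * 0"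
  proof (rule state_bound[OF f Ck_on_1_slab(1)[OF C1] _ _ _ t])
    show "u differentiable (at (y, s))" if "0 < s" "s < T" for y s
      using Ck_on_1_slab(2)[OF C1 that] unfolding differentiable_def by blast
    show "ennreal \<bar>u (y, 0)\<bar> \<le> Linf_norm UNIV u0" for y
      using Linf_norm_ge[of UNIV UNIV u0 y] u u0 by (simp add: classical_solution_def)
  qed (use u in \<open>auto simp: classical_solution_def\<close>)
  then show ?thesis by simp
qed

lemma network_state_bound:
  fixes f :: "real \<Rightarrow> 'a::euclidean_space" and U :: "'a \<times> real \<Rightarrow> real"
  assumes f: "continuous_on UNIV f" and u0: "continuous_on UNIV u0"
    and U: "\<And>p. U differentiable (at p)"
    and \<epsilon>: "continuous_on UNIV (L_i f U)" "continuous_on UNIV (L_b u0 U)"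
    and t: "0 < t" "t < T"
  shows "ennreal \<bar>U (x, t)\<bar> \<le> Linf_norm UNIV u0 + Linf_norm UNIV (L_b u0 U)
    + ennreal T * Linf_norm (UNIV \<times> {0..T}) (L_i f U)"
proof (rule state_bound[OF f _ U _ _ t])
  show "continuous_on (UNIV \<times> {0..T}) U"
    by (intro differentiable_imp_continuous_on differentiable_at_imp_differentiable_on U)
  show "ennreal \<bar>U (y, 0)\<bar> \<le> Linf_norm UNIV u0 + Linf_norm UNIV (L_b u0 U)" for y
  proof -
    have "ennreal \<bar>U (y, 0)\<bar> \<le> ennreal (\<bar>u0 y\<bar> + \<bar>L_b u0 U y\<bar>)"
      by (intro ennreal_leI) (simp add: L_b_def)
    also have "\<dots> \<le> Linf_norm UNIV u0 + Linf_norm UNIV (L_b u0 U)"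
      using Linf_norm_ge[of UNIV UNIV u0 y] Linf_norm_ge[of UNIV UNIV "L_b u0 U" y] u0 \<epsilon>
      by (auto intro: add_mono)
    finally show ?thesis .
  qed
  show "ennreal \<bar>L_i f U (y, s)\<bar> \<le> Linf_norm (UNIV \<times> {0..T}) (L_i f U)" if "0 < s" "s < T" for y s
    using slab_Linf_norm_ge[OF continuous_on_subset[OF \<epsilon>(1)] that] by simp
qed

lemma classical_solution_grad_bound:
  assumes u: "classical_solution T f u0 u" and P: "0 \<le> P"
    "Linf_norm (UNIV \<times> {0..T}) (space_grad u) \<le> ennreal P"
    and t: "0 < t" "t < T"
  shows "norm (space_grad u (x, t)) \<le> P"
proof -
  have "Ck_on 1 (UNIV \<times> {0..T}) u"
    using u by (simp add: classical_solution_def)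
  from slab_Linf_norm_ge[OF Ck_on_1_slab(4)[OF this] t, of x] P show ?thesis
    by (metis ennreal_le_iff order_trans)
qed

text \<open>Only the last space variable moves: this compares the state \<open>u\<close> on the
  exact interface with \<open>u\<close> on the approximate one, at the same x'.\<close>

lemma classical_solution_lipschitz:
  fixes u :: "('a::euclidean_space \<times> real) \<times> real \<Rightarrow> real"
  assumes u: "classical_solution T f u0 u" and P: "0 \<le> P"
    "Linf_norm (UNIV \<times> {0..T}) (space_grad u) \<le> ennreal P"
    and t: "0 < t" "t < T"
  shows "\<bar>u ((x, z), t) - u ((x, z'), t)\<bar> \<le> P * \<bar>z - z'\<bar>"
proof -
  have C1: "Ck_on 1 (UNIV \<times> {0..T}) u"
    using u by (simp add: classical_solution_def)
  have "norm (u ((x, z), t) - u ((x, z'), t)) \<le> P * norm (z - z')"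
  proof (rule differentiable_bound[OF convex_UNIV])
    fix r :: real
    let ?D = "frechet_derivative u (at ((x, r), t) within UNIV \<times> {0..T})"
    have D: "(u has_derivative ?D) (at ((x, r), t))"
      by (rule Ck_on_1_slab(2)[OF C1 t])
    show "((\<lambda>z. u ((x, z), t)) has_derivative (\<lambda>k. ?D ((0, k), 0))) (at r)"
      by (rule has_derivative_compose[where f = "\<lambda>z. ((x, z), t)" and g = u])
        (auto intro!: derivative_eq_intros D)
    show "onorm (\<lambda>k. ?D ((0, k), 0)) \<le> P"
    proof (rule onorm_le)
      fix k :: real
      have "norm (?D ((0, k), 0)) = \<bar>inner (0, k) (space_grad u ((x, r), t))\<bar>"
        using has_derivative_space_grad(2)[OF D] by simp
      also have "\<dots> \<le> norm (0 :: 'a, k) * norm (space_grad u ((x, r), t))"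
        by (rule Cauchy_Schwarz_ineq2)
      also have "\<dots> \<le> norm k * P"
        by (intro mult_mono classical_solution_grad_bound[OF u P t]) (auto simp: norm_Pair)
      finally show "norm (?D ((0, k), 0)) \<le> P * norm k" by (simp add: mult.commute)
    qed
  qed auto
  then show ?thesis by simp
qed

text \<open>Origin of the exponential in C_0: the radius, the sum of the two state bounds, contains
  the ranges of both \<open>u\<close> and \<open>U\<close>, and \<open>f'\<close> on that ball times
  the gradient bound \<open>P\<close> is the growth rate of the error.\<close>

lemma network_state_error:
  fixes f :: "real \<Rightarrow> 'a::euclidean_space" and u U :: "'a \<times> real \<Rightarrow> real"
  assumes f: "\<And>v. (f has_vector_derivative f' v) (at v)" and f': "continuous_on UNIV f'"
    and u0: "continuous_on UNIV u0" "Linf_norm UNIV u0 < \<infinity>"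
    and U: "\<And>p. U differentiable (at p)"
    and \<epsilon>: "continuous_on UNIV (L_i f U)" "continuous_on UNIV (L_b u0 U)"
    and u: "classical_solution T f u0 u"
    and P: "Linf_norm (UNIV \<times> {0..T}) (space_grad u) \<le> P" "P < \<infinity>"
    and t: "0 < t" "t < T"
  defines "E \<equiv> Linf_norm UNIV (L_b u0 U) + ennreal T * Linf_norm (UNIV \<times> {0..T}) (L_i f U)"
  assumes E: "E < \<infinity>"
  shows "ennreal \<bar>U (x, t) - u (x, t)\<bar>
    \<le> E * ennexp (ennreal T * P * Linf_norm (ball0 (Linf_norm UNIV u0 + (Linf_norm UNIV u0 + E))) f')"
proof -
  define \<rho> where "\<rho> = Linf_norm UNIV u0 + (Linf_norm UNIV u0 + E)"
  have \<rho>: "\<rho> < \<infinity>" using u0 E by (simp add: \<rho>_def)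
  have f_cont: "continuous_on UNIV f"
    using f by (meson continuous_at_imp_continuous_on has_vector_derivative_continuous)
  obtain B where B: "0 \<le> B" "\<And>r. ennreal \<bar>r\<bar> \<le> \<rho> \<Longrightarrow> norm (f r) \<le> B"
    by (rule bounded_on_ennreal_ball[OF f_cont \<rho>]) blast
  obtain L where L: "0 \<le> L" "Linf_norm (ball0 \<rho>) f' = ennreal L"
    using Linf_norm_ball0_finite[OF f' \<rho>] by (cases "Linf_norm (ball0 \<rho>) f'") auto
  obtain P' where P': "0 \<le> P'" "P = ennreal P'" using P(2) by (cases P) auto
  have "Linf_norm UNIV (L_b u0 U) < \<infinity>" "Linf_norm (UNIV \<times> {0..T}) (L_i f U) < \<infinity>"
    using E t by (auto simp: E_def ennreal_mult_less_top)
  then obtain Eb Ei where Eb: "0 \<le> Eb" "Linf_norm UNIV (L_b u0 U) = ennreal Eb"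
    and Ei: "0 \<le> Ei" "Linf_norm (UNIV \<times> {0..T}) (L_i f U) = ennreal Ei"
    by (cases "Linf_norm UNIV (L_b u0 U)"; cases "Linf_norm (UNIV \<times> {0..T}) (L_i f U)") auto
  have "\<bar>U (x, t) - u (x, t)\<bar> \<le> (Eb + t * Ei) * exp (t * (L * P'))"
  proof (rule state_error[OF U u, where W = "{r. ennreal \<bar>r\<bar> \<le> \<rho>}"])
    fix y :: 'a and s :: real assume s: "0 < s" "s < T"
    have "ennreal \<bar>U (y, s)\<bar> \<le> Linf_norm UNIV u0 + E"
      using network_state_bound[OF f_cont u0(1) U \<epsilon> s, of y] by (simp add: E_def add.assoc)
    moreover have "ennreal \<bar>u (y, s)\<bar> \<le> Linf_norm UNIV u0"
      by (rule classical_solution_bound[OF f_cont u0(1) u s])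
    ultimately show "U (y, s) \<in> {r. ennreal \<bar>r\<bar> \<le> \<rho>} \<and> u (y, s) \<in> {r. ennreal \<bar>r\<bar> \<le> \<rho>}"
      unfolding \<rho>_def by (auto intro: add_increasing add_increasing2)
    show "norm (space_grad u (y, s)) \<le> P'"
      by (rule classical_solution_grad_bound[OF u P'(1) _ s]) (use P P' in simp)
    show "\<bar>L_i f U (y, s)\<bar> \<le> Ei"
      using slab_Linf_norm_ge[OF continuous_on_subset[OF \<epsilon>(1)] s, of y] Ei by simp
  next
    show "\<bar>L_b u0 U y\<bar> \<le> Eb" for y
      using Linf_norm_ge[of UNIV UNIV "L_b u0 U" y] \<epsilon> Eb by simp
    show "norm (f r - f r') \<le> L * \<bar>r - r'\<bar>"
      if "r \<in> {r. ennreal \<bar>r\<bar> \<le> \<rho>}" "r' \<in> {r. ennreal \<bar>r\<bar> \<le> \<rho>}" for r r'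
      using lipschitz_ball0[OF f f' L(1), of \<rho> r r'] that L by simp
  qed (use B L P' Eb Ei t in auto)
  also have "\<dots> \<le> (Eb + T * Ei) * exp (T * P' * L)"
    using t Ei Eb P' L
    by (intro mult_mono add_mono mult_right_mono) (auto simp: mult_ac intro!: mult_left_mono)
  finally have "ennreal \<bar>U (x, t) - u (x, t)\<bar> \<le> ennreal ((Eb + T * Ei) * exp (T * P' * L))"
    by (rule ennreal_leI)
  also have "\<dots> = E * ennexp (ennreal T * P * Linf_norm (ball0 \<rho>) f')"
    unfolding E_def Eb(2) Ei(2) P'(2) L(2) using t Ei Eb P' L
    by (simp add: ennexp_ennreal flip: ennreal_plus ennreal_mult)
  finally show ?thesis unfolding \<rho>_def .
qed

lemma interface_estimate:
  fixes f :: "real \<Rightarrow> (real^'n) \<times> real"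
    and u U :: "pm \<Rightarrow> ((real^'n) \<times> real) \<times> real \<Rightarrow> real"
    and g h :: "(real^'n) \<times> real \<Rightarrow> real" and C :: "pm \<Rightarrow> real"
  assumes f: "\<And>v. (f has_vector_derivative f' v) (at v)" and f': "continuous_on UNIV f'"
    and u0: "\<And>s. Ck_on 1 UNIV (u0 s)" "\<And>s. compact (closure {x. u0 s x \<noteq> 0})"
    and T: "0 < T" "T \<le> 1"
    and u: "\<And>s. classical_solution T f (u0 s) (u s)"
    and U: "\<And>s p. U s differentiable (at p)"
    and \<epsilon>: "\<And>s. continuous_on UNIV (L_i f (U s))" "\<And>s. continuous_on UNIV (L_b (u0 s) (U s))"
    and g: "interface_solution T f u g0 g"
    and h: "\<And>p. h differentiable (at p)"
    and \<sigma>: "continuous_on (UNIV \<times> {0..T}) (K_i f U h)" "continuous_on UNIV (K_b g0 h)"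
  defines "nf \<equiv> \<lambda>\<rho>. Linf_norm (ball0 \<rho>) f'"
    and "\<rho>\<^sub>0 \<equiv> \<lambda>s. Linf_norm UNIV (u0 s)"
    and "\<epsilon>\<^sub>b \<equiv> \<lambda>s. Linf_norm UNIV (L_b (u0 s) (U s))"
    and "\<epsilon>\<^sub>i \<equiv> \<lambda>s. Linf_norm (UNIV \<times> {0..T}) (L_i f (U s))"
    and "G \<equiv> Linf_norm (UNIV \<times> {0..T}) (space_grad g)"
  defines "\<rho>\<^sub>0\<^sub>U \<equiv> \<lambda>s. \<rho>\<^sub>0 s + \<epsilon>\<^sub>b s + ennreal T * \<epsilon>\<^sub>i s"
    and "\<rho>\<^sub>1 \<equiv> \<lambda>s. Linf_norm UNIV (grad (u0 s)) + ennreal (C s) * nf (\<rho>\<^sub>0 s)"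
  defines "R \<equiv> \<rho>\<^sub>0 Plus + \<rho>\<^sub>0 Minus + \<rho>\<^sub>0\<^sub>U Plus + \<rho>\<^sub>0\<^sub>U Minus"
  assumes grad_u: "\<And>s. Linf_norm (UNIV \<times> {0..T}) (space_grad (u s)) \<le> \<rho>\<^sub>1 s"
  defines "C\<^sub>0 \<equiv> \<lambda>s. (1 + G) * nf R * ennexp (ennreal T * \<rho>\<^sub>1 s * nf (\<rho>\<^sub>0 s + \<rho>\<^sub>0\<^sub>U s))"
    and "C\<^sub>1 \<equiv> (1 + G) * (\<rho>\<^sub>1 Plus + \<rho>\<^sub>1 Minus) * nf R"
  shows "Linf_norm (UNIV \<times> {0..T}) (\<lambda>y. h y - g y)
    \<le> (Linf_norm UNIV (K_b g0 h) + Linf_norm (UNIV \<times> {0..T}) (K_i f U h)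
        + (\<Sum>s\<in>{Plus, Minus}. C\<^sub>0 s * ennreal T * (\<epsilon>\<^sub>b s + ennreal T * \<epsilon>\<^sub>i s)))
      * ennexp (ennreal T * C\<^sub>1)"
    (is "_ \<le> ?rhs")
proof (cases "?rhs = \<infinity>")
  case False
  define E where "E s = \<epsilon>\<^sub>b s + ennreal T * \<epsilon>\<^sub>i s" for s
  let ?Sb = "Linf_norm UNIV (K_b g0 h)" and ?Si = "Linf_norm (UNIV \<times> {0..T}) (K_i f U h)"
  let ?X = "ennexp (ennreal T * C\<^sub>1)"
  have rhs: "?rhs = (?Sb + ?Si + (C\<^sub>0 Plus * ennreal T * E Plus + C\<^sub>0 Minus * ennreal T * E Minus)) * ?X"
    by (simp add: E_def)
  \<comment> \<open>Finiteness of a product passes to a factor only if the other factor is not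
    0.\<close>
  have X: "?X \<noteq> 0" using ennexp_ge_1[of "ennreal T * C\<^sub>1"] by auto
  have "?Sb < \<infinity>" "?Si < \<infinity>" and C0E: "C\<^sub>0 s * ennreal T * E s \<noteq> \<infinity>" for s
    using False X unfolding rhs by (cases s; auto simp: ennreal_mult_eq_top_iff less_top)+
  then obtain Sb Si where Sb: "0 \<le> Sb" "?Sb = ennreal Sb" and Si: "0 \<le> Si" "?Si = ennreal Si"
    by (cases ?Sb; cases ?Si) auto
  have Sb_le: "\<bar>K_b g0 h x\<bar> \<le> Sb" for x
    using Linf_norm_ge[of UNIV UNIV "K_b g0 h" x] \<sigma> Sb by simp
  have "continuous_on (UNIV \<times> {0<..<T}) (K_i f U h)"
    by (rule continuous_on_subset[OF \<sigma>(1)]) auto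
  note Si_ge = slab_Linf_norm_ge[OF this]
  have Si_le: "\<bar>K_i f U h (x, t)\<bar> \<le> Si" if "0 < t" "t < T" for x t
    using Si_ge[OF that, of x] Si by simp
  have f_cont: "continuous_on UNIV f"
    using f by (meson continuous_at_imp_continuous_on has_vector_derivative_continuous)
  note u0_facts = C1_compact_support_finite[OF u0]
  show ?thesis
  proof (cases "\<forall>s. E s < \<infinity>")
    case True
    have \<rho>\<^sub>0: "\<rho>\<^sub>0 s < \<infinity>" for s using u0_facts by (simp add: \<rho>\<^sub>0_def)
    have \<rho>\<^sub>0\<^sub>U_eq: "\<rho>\<^sub>0\<^sub>U s = \<rho>\<^sub>0 s + E s" for s by (simp add: \<rho>\<^sub>0\<^sub>U_def E_def add.assoc)
    have R: "R < \<infinity>" using \<rho>\<^sub>0 True by (simp add: R_def \<rho>\<^sub>0\<^sub>U_eq)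
    have nf_finite: "nf \<rho> < \<infinity>" if "\<rho> < \<infinity>" for \<rho>
      unfolding nf_def by (rule Linf_norm_ball0_finite[OF f' that])
    have \<rho>\<^sub>1: "\<rho>\<^sub>1 s < \<infinity>" for s
      using u0_facts nf_finite[OF \<rho>\<^sub>0] by (simp add: \<rho>\<^sub>1_def ennreal_mult_less_top)
    define P where "P s = enn2real (\<rho>\<^sub>1 s)" for s
    have P: "0 \<le> P s" "\<rho>\<^sub>1 s = ennreal (P s)" for s
      using \<rho>\<^sub>1[of s] by (auto simp: P_def)
    \<comment> \<open>\<open>Q s\<close> is the state error bound. Multiplied by
      \<open>(1 + G) * nf R\<close> it becomes \<open>C\<^sub>0 s * E s\<close>, so the constant C_0
      combines the error of a state with its effect on the coefficients.\<close>
    define Q where "Q s = E s * ennexp (ennreal T * \<rho>\<^sub>1 s * nf (\<rho>\<^sub>0 s + \<rho>\<^sub>0\<^sub>U s))" for s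
    have Q_fin: "Q s < \<infinity>" for s
    proof -
      have "nf (\<rho>\<^sub>0 s + \<rho>\<^sub>0\<^sub>U s) < \<infinity>"
        using \<rho>\<^sub>0 True by (intro nf_finite) (simp add: \<rho>\<^sub>0\<^sub>U_eq)
      then have "ennexp (ennreal T * \<rho>\<^sub>1 s * nf (\<rho>\<^sub>0 s + \<rho>\<^sub>0\<^sub>U s)) < \<infinity>"
        using \<rho>\<^sub>1[of s] by (auto simp: ennexp_def ennreal_mult_eq_top_iff)
      then show ?thesis using True by (simp add: Q_def ennreal_mult_less_top)
    qed
    define Q' where "Q' s = enn2real (Q s)" for s
    have Q': "0 \<le> Q' s" "Q s = ennreal (Q' s)" for s
      using Q_fin[of s] by (auto simp: Q'_def)
    obtain L where L: "0 \<le> L" "nf R = ennreal L"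
      using nf_finite[OF R] by (cases "nf R") auto
    obtain B where B: "0 \<le> B" "\<And>r. ennreal \<bar>r\<bar> \<le> R \<Longrightarrow> norm (f r) \<le> B"
      by (rule bounded_on_ennreal_ball[OF f_cont R]) blast
    have state: "\<bar>U s (x, t) - u s (x, t)\<bar> \<le> Q' s" if "0 < t" "t < T" for s x t
    proof -
      have "ennreal \<bar>U s (x, t) - u s (x, t)\<bar> \<le> Q s"
        unfolding Q_def E_def nf_def \<rho>\<^sub>0\<^sub>U_eq \<rho>\<^sub>0_def \<epsilon>\<^sub>b_def \<epsilon>\<^sub>i_def
        by (rule network_state_error[OF f f' u0_facts(3,1) U \<epsilon> u grad_u \<rho>\<^sub>1 that])
          (use True in \<open>simp add: E_def \<epsilon>\<^sub>b_def \<epsilon>\<^sub>i_def\<close>)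
      then show ?thesis using Q' by simp
    qed
    have "Linf_norm (UNIV \<times> {0..T}) (\<lambda>y. h y - g y)
      \<le> (ennreal Sb + ennreal Si + (1 + G) * (ennreal (T * (L * Q' Plus)) + ennreal (T * (L * Q' Minus))))
        * ennexp (ennreal T * ((1 + G) * (ennreal (L * P Plus) + ennreal (L * P Minus))))"
      unfolding G_def
    proof (rule interface_error_Linf[OF T f_cont convex_ennreal_ball[of R], where B = B and L = L and
          M = "\<lambda>s. L * Q' s" and N = "\<lambda>s. L * P s"])
      fix s x and t :: real assume t: "0 < t" "t < T"
      have "ennreal \<bar>U s (x, t)\<bar> \<le> \<rho>\<^sub>0\<^sub>U s"
        using network_state_bound[OF f_cont u0_facts(3)[of s] U[of s] \<epsilon>(1)[of s] \<epsilon>(2)[of s] t, of x]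
        by (simp add: \<rho>\<^sub>0\<^sub>U_def \<rho>\<^sub>0_def \<epsilon>\<^sub>b_def \<epsilon>\<^sub>i_def)
      moreover have "ennreal \<bar>u s (x, t)\<bar> \<le> \<rho>\<^sub>0 s"
        unfolding \<rho>\<^sub>0_def by (rule classical_solution_bound[OF f_cont u0_facts(3) u t])
      moreover have "\<rho>\<^sub>0 s \<le> R" "\<rho>\<^sub>0\<^sub>U s \<le> R"
        by (cases s; auto simp: R_def intro: add_increasing add_increasing2)+
      ultimately show "U s (x, t) \<in> {r. ennreal \<bar>r\<bar> \<le> R} \<and> u s (x, t) \<in> {r. ennreal \<bar>r\<bar> \<le> R}"
        by auto
      show "L * \<bar>U s (x, t) - u s (x, t)\<bar> \<le> L * Q' s"
        using state[OF t] L by (intro mult_left_mono)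
    next
      fix s x z z' and t :: real assume t: "0 < t" "t < T"
      have "L * \<bar>u s ((x, z), t) - u s ((x, z'), t)\<bar> \<le> L * (P s * \<bar>z - z'\<bar>)"
        by (intro mult_left_mono classical_solution_lipschitz[OF u P(1) _ t] L) (use grad_u P in simp)
      then show "L * \<bar>u s ((x, z), t) - u s ((x, z'), t)\<bar> \<le> L * P s * \<bar>z - z'\<bar>"
        by (simp add: mult.assoc)
    next
      show "norm (f r - f r') \<le> L * \<bar>r - r'\<bar>"
        if "r \<in> {r. ennreal \<bar>r\<bar> \<le> R}" "r' \<in> {r. ennreal \<bar>r\<bar> \<le> R}" for r r'
        using lipschitz_ball0[OF f f' L(1), of R r r'] that L by (simp add: nf_def)
    qed (use L P Q' B h g Si_le Sb_le Sb(1) Si(1) in auto)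
    also have "\<dots> = ?rhs"
    proof -
      have LP: "ennreal (L * P s) = nf R * \<rho>\<^sub>1 s" for s
        using L P by (simp add: ennreal_mult)
      have N: "(1 + G) * (ennreal (L * P Plus) + ennreal (L * P Minus)) = C\<^sub>1"
        unfolding C\<^sub>1_def LP distrib_left[symmetric] by (simp only: mult_ac)
      have "(1 + G) * ennreal (T * (L * Q' s)) = C\<^sub>0 s * ennreal T * E s" for s
      proof -
        have "ennreal (T * (L * Q' s)) = ennreal T * (nf R * Q s)"
          using L Q' T by (simp add: ennreal_mult)
        then show ?thesis
          by (simp only: C\<^sub>0_def Q_def mult_ac)
      qed
      then have M: "(1 + G) * (ennreal (T * (L * Q' Plus)) + ennreal (T * (L * Q' Minus)))
          = C\<^sub>0 Plus * ennreal T * E Plus + C\<^sub>0 Minus * ennreal T * E Minus"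
        by (simp only: distrib_left)
      show ?thesis
        unfolding M N Sb(2)[symmetric] Si(2)[symmetric] by (rule rhs[symmetric])
    qed
    finally show ?thesis .
  next
    txt \<open>An unbounded network residual leaves the right-hand side finite only if \<open>f\<close> is constant.\<close>
    case False
    then obtain s where "\<not> E s < \<infinity>" by blast
    then have s: "E s = \<infinity>" by (simp add: not_less top_unique)
    then have R: "R = \<infinity>"
      by (cases s) (auto simp: R_def \<rho>\<^sub>0\<^sub>U_def E_def add.assoc)
    \<comment> \<open>A product of \<open>C\<^sub>0 s\<close> with T * \<infinity> avoids
      \<infinity> only for \<open>C\<^sub>0 s = 0\<close>. The factors 1 + G and
      \<open>ennexp\<close> are at least 1, so \<open>nf R\<close> must vanish, and with R =
      \<infinity> its ball is the whole line.\<close>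
    have "C\<^sub>0 s = 0"
      using C0E[of s] s T by (auto simp: ennreal_mult_eq_top_iff)
    moreover have "ennexp (ennreal T * \<rho>\<^sub>1 s * nf (\<rho>\<^sub>0 s + \<rho>\<^sub>0\<^sub>U s)) \<noteq> 0"
      using ennexp_ge_1[of "ennreal T * \<rho>\<^sub>1 s * nf (\<rho>\<^sub>0 s + \<rho>\<^sub>0\<^sub>U s)"] by auto
    ultimately have nf0: "nf R = 0" by (auto simp: C\<^sub>0_def)
    have const: "norm (f r - f r') \<le> 0 * \<bar>r - r'\<bar>" for r r'
      by (rule lipschitz_ball0[OF f f', of 0 R]) (use nf0 R in \<open>auto simp: nf_def\<close>)
    have f_le: "norm (f r) \<le> norm (f 0)" for r
      using const[of r 0] by simp
    \<comment> \<open>For constant \<open>f\<close> the coefficients ignore the states, so the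
      infinite state errors do not reach the interface: \<open>M\<close> and \<open>N\<close> are
      0.\<close>
    have "Linf_norm (UNIV \<times> {0..T}) (\<lambda>y. h y - g y)
      \<le> (ennreal Sb + ennreal Si + (1 + G) * (ennreal (T * 0) + ennreal (T * 0)))
        * ennexp (ennreal T * ((1 + G) * (ennreal 0 + ennreal 0)))"
      unfolding G_def
      by (rule interface_error_Linf[OF T f_cont convex_UNIV, where B = "norm (f 0)" and L = 0 and
            M = "\<lambda>_. 0" and N = "\<lambda>_. 0"])
        (use f_le const h g Si_le Sb_le Sb(1) Si(1) in auto)
    also have "\<dots> = (ennreal Sb + ennreal Si) * ennexp 0" by simp
    also have "\<dots> \<le> ?rhs"
      unfolding rhs unfolding Sb(2) Si(2) by (intro mult_mono ennexp_mono) auto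
    finally show ?thesis .
  qed
next
  case True
  then show ?thesis by (simp only: infinity_ennreal_def top_greatest)
qed

theorem theorem2p4:
  fixes F f :: "real \<Rightarrow> (real^'n) \<times> real"
    and u0 :: "pm \<Rightarrow> (real^'n) \<times> real \<Rightarrow> real"
    and g0 :: "real^'n \<Rightarrow> real"
  assumes F_C2: "Ck_on 2 UNIV F"
    and f_eq: "\<And>v. (F has_vector_derivative f v) (at v)"
    and u0_C1: "\<And>s. Ck_on 1 UNIV (u0 s)"
    and u0_supp: "\<And>s. compact (closure {x. u0 s x \<noteq> 0})"
    and g0_C1b: "Ck_on 1 UNIV g0" "bounded (range g0)" "bounded (range (grad g0))"
  shows "\<forall>\<^sub>F T in at_right 0.
    \<forall>(\<sigma> :: real \<Rightarrow> real) (A :: nat list) (A' :: nat list) (k :: nat) (m :: nat) (p :: nat) (q :: nat)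
     (u :: pm \<Rightarrow> ((real^'n) \<times> real) \<times> real \<Rightarrow> real)
     (U :: pm \<Rightarrow> ((real^'n) \<times> real) \<times> real \<Rightarrow> real)
     (g :: (real^'n) \<times> real \<Rightarrow> real) (h :: (real^'n) \<times> real \<Rightarrow> real) (C :: pm \<Rightarrow> real).
    let
      slab = (UNIV :: ((real^'n) \<times> real) set) \<times> {0..T};
      slab' = (UNIV :: (real^'n) set) \<times> {0..T};
      \<epsilon>\<^sub>i = (\<lambda>s. L_i f (U s));
      \<epsilon>\<^sub>b = (\<lambda>s. L_b (u0 s) (U s));
      \<sigma>\<^sub>i = K_i f U h;
      \<sigma>\<^sub>b = K_b g0 h;
      f'_norm = (\<lambda>\<rho>. Linf_norm (ball0 \<rho>) (\<lambda>v. vector_derivative f (at v)));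
      \<rho>\<^sub>0 = (\<lambda>s. Linf_norm UNIV (u0 s));
      \<rho>\<^sub>0\<^sub>U = (\<lambda>s. Linf_norm UNIV (u0 s) + Linf_norm UNIV (\<epsilon>\<^sub>b s)
                 + ennreal T * Linf_norm slab (\<epsilon>\<^sub>i s));
      \<rho>\<^sub>1 = (\<lambda>s. Linf_norm UNIV (grad (u0 s)) + ennreal (C s) * f'_norm (\<rho>\<^sub>0 s));
      R = \<rho>\<^sub>0 Plus + \<rho>\<^sub>0 Minus + \<rho>\<^sub>0\<^sub>U Plus + \<rho>\<^sub>0\<^sub>U Minus;
      G = Linf_norm slab' (space_grad g);
      C\<^sub>0 = (\<lambda>s. (1 + G) * f'_norm R
                * ennexp (ennreal T * \<rho>\<^sub>1 s * f'_norm (\<rho>\<^sub>0 s + \<rho>\<^sub>0\<^sub>U s)));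
      C\<^sub>1 = (1 + G) * (\<rho>\<^sub>1 Plus + \<rho>\<^sub>1 Minus) * f'_norm R
    in
      smooth_on UNIV \<sigma> \<longrightarrow> \<not> linear \<sigma> \<longrightarrow>
      architecture (CARD('n) + 2) A \<longrightarrow> architecture (CARD('n) + 1) A' \<longrightarrow>
      (\<forall>s. classical_solution T f (u0 s) (u s)) \<longrightarrow>
      (\<forall>s. is_arg_min (L_loss k m T f (u0 s)) (\<lambda>v. v \<in> networks \<sigma> A) (U s)) \<longrightarrow>
      (\<forall>s. smooth_on UNIV (\<epsilon>\<^sub>i s) \<and> smooth_on UNIV (\<epsilon>\<^sub>b s)) \<longrightarrow>
      interface_solution T f u g0 g \<longrightarrow>
      is_arg_min (K_loss p q T f U g0) (\<lambda>v. v \<in> networks \<sigma> A') h \<longrightarrow>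
      smooth_on slab' \<sigma>\<^sub>i \<longrightarrow> smooth_on UNIV \<sigma>\<^sub>b \<longrightarrow>
      (\<forall>s. 0 \<le> C s \<and> Linf_norm slab (space_grad (u s)) \<le> \<rho>\<^sub>1 s) \<longrightarrow>
      Linf_norm slab' (\<lambda>y. h y - g y)
        \<le> (Linf_norm UNIV \<sigma>\<^sub>b + Linf_norm slab' \<sigma>\<^sub>i
            + (\<Sum>s\<in>{Plus, Minus}. C\<^sub>0 s * ennreal T
                 * (Linf_norm UNIV (\<epsilon>\<^sub>b s) + ennreal T * Linf_norm slab (\<epsilon>\<^sub>i s))))
          * ennexp (ennreal T * C\<^sub>1)"
proof -
  note f' = C2_derivative[OF F_C2 f_eq]
  have smooth_imp_continuous: "continuous_on S v" if "smooth_on S v"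
    for v :: "'b::euclidean_space \<Rightarrow> real" and S
    using that Ck_on.simps(1) unfolding smooth_on_def by blast
  \<comment> \<open>The solutions, networks and residuals are quantified under the filter, so the
    eventuality only has to supply 0 < T and T \<le> 1.\<close>
  have "\<forall>\<^sub>F T :: real in at_right 0. T \<in> {0<..<1}"
    by (rule eventually_at_right_real) simp
  then show ?thesis
  proof (rule eventually_mono, unfold Let_def, intro allI impI, goal_cases)
    case (1 T \<sigma> A A' k m p q u U g h C)
    show ?case
    proof (rule interface_estimate[OF f' u0_C1 u0_supp])
      show "U s differentiable (at y)" for s y
        using 1 by (auto simp: is_arg_min_def intro: network_differentiable)
      show "h differentiable (at y)" for y
        using 1 by (auto simp: is_arg_min_def intro: network_differentiable)
    qed (use 1 in \<open>auto intro: smooth_imp_continuous\<close>)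
  qed
qed

end
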